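(* Let $(M,F)$ be a Landsberg space with geodesic spray $S$, and suppose that $(M,F)$ admits a (nonzero) parallel 1-form. Then $S$ has metrizability freedom at least $2$.
   Context: $M$ is a smooth manifold of dimension $n\ge 2$, $\mathcal{T}M$ is the bundle of nonzero tangent vectors, $(x^i,y^i)$ are the induced coordinates on $TM$, $\partial_i=\partial/\partial x^i$, $\dot\partial_i=\partial/\partial y^i$; the summation convention is used. A Finsler space $(M,F)$ is such an $M$ with a function $F:TM\to\mathbb{R}$ that is strictly positive and smooth on $\mathcal{T}M$, positively 1-homogeneous in $y$, and such that $g_{ij}=\dot\partial_i\dot\partial_j(\tfrac12F^2)$ has rank $n$. Its geodesic spray is $S=y^j\partial_j-2G^j\dot\partial_j$, with $G^i=\tfrac14 g^{il}\left(y^k\partial_k\dot\partial_l F^2-\partial_l F^2\right)$. Put $G^h_j=\dot\partial_jG^h$, $G^h_{ij}=\dot\partial_iG^h_j$ (Berwald connection coefficients), $G^h_{ijk}=\dot\partial_kG^h_{ij}$ (Berwald curvature). The Landsberg curvature is $L_{ijk}=-\tfrac12F\,G^h_{ijk}\,\dot\partial_hF$; $(M,F)$ is a Landsberg space if $L_{ijk}\equiv 0$. A 1-form $\beta=b_i(x)y^i$ is parallel if its Berwald horizontal covariant derivative vanishes: $b_{i|j}=\partial_jb_i-G^h_{ij}b_h=0$ on $\mathcal{T}M$. Parallel 1-forms are understood to be nonzero. The metrizability freedom of a metrizable spray $S$ is the number of functionally independent Finsler functions which, locally, have $S$ as geodesic spray and generate (by functional combination) all Finsler functions having $S$ as geodesic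 spray; thus metrizability freedom at least $2$ means that locally there exist two functionally independent Finsler functions $F_1,F_2$ (i.e. $dF_1\wedge dF_2\neq0$) both having $S$ as geodesic spray. *)

theory Defs
  imports "HOL-Analysis.Analysis"
begin

section \<open>Smooth functions on open subsets of Euclidean space\<close>

primrec Ck_on :: "nat \<Rightarrow> 'a::euclidean_space set \<Rightarrow> ('a \<Rightarrow> 'b::real_normed_vector) \<Rightarrow> bool" where
  "Ck_on 0 S f \<longleftrightarrow> continuous_on S f"
| "Ck_on (Suc k) S f \<longleftrightarrow>
     (\<forall>x\<in>S. f differentiable (at x)) \<and> (\<forall>v. Ck_on k S (\<lambda>x. frechet_derivative f (at x) v))"

definition smooth_on :: "'a::euclidean_space set \<Rightarrow> ('a \<Rightarrow> 'b::real_normed_vector) \<Rightarrow> bool" where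
  "smooth_on S f \<longleftrightarrow> (\<forall>k. Ck_on k S f)"


section \<open>Smooth manifolds\<close>

text \<open>A chart is a pair of its domain and its coordinate map. The values of the coordinate map
  outside the domain are irrelevant.\<close>

type_synonym ('m, 'n) chart = "'m set \<times> ('m \<Rightarrow> real ^ 'n)"

abbreviation cdom :: "('m, 'n::finite) chart \<Rightarrow> 'm set" where
  "cdom c \<equiv> fst c"

abbreviation cmap :: "('m, 'n::finite) chart \<Rightarrow> 'm \<Rightarrow> real ^ 'n" where
  "cmap c \<equiv> snd c"

abbreviation cinv :: "('m, 'n::finite) chart \<Rightarrow> real ^ 'n \<Rightarrow> 'm" where
  "cinv c \<equiv> inv_into (cdom c) (cmap c)"

definition transition ::
  "('m, 'n::finite) chart \<Rightarrow> ('m, 'n) chart \<Rightarrow> real ^ 'n \<Rightarrow> real ^ 'n" where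
  "transition c d = (\<lambda>x. cmap d (cinv c x))"

definition smooth_manifold :: "'m topology \<Rightarrow> ('m, 'n::finite) chart set \<Rightarrow> bool" where
  "smooth_manifold X A \<longleftrightarrow>
     Hausdorff_space X \<and> second_countable X \<and>
     \<Union> (cdom ` A) = topspace X \<and>
     (\<forall>c\<in>A. openin X (cdom c) \<and> open (cmap c ` cdom c) \<and>
        homeomorphic_map (subtopology X (cdom c)) (top_of_set (cmap c ` cdom c)) (cmap c)) \<and>
     (\<forall>c\<in>A. \<forall>d\<in>A. smooth_on (cmap c ` (cdom c \<inter> cdom d)) (transition c d))"


section \<open>The tangent bundle\<close>

text \<open>A tangent vector at p is given by its components in all charts around p, transforming by
  the derivatives of the transition maps (and set to 0 in the charts not around p); the
  tangent bundle consists of the pairs of a point and a tangent vector there.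
  Then \<open>tangent_vec A c x y\<close> is the element of the tangent bundle with induced coordinates (x, y) in
  the chart c, i.e. y^i d/dx^i at the point with coordinates x. Every element over a point of
  the domain of c has exactly one such representation.\<close>

type_synonym ('m, 'n) tangent = "'m \<times> (('m, 'n) chart \<Rightarrow> real ^ 'n)"

definition tangent_vec ::
  "('m, 'n::finite) chart set \<Rightarrow> ('m, 'n) chart \<Rightarrow> real ^ 'n \<Rightarrow> real ^ 'n \<Rightarrow> ('m, 'n) tangent" where
  "tangent_vec A c x y =
     (cinv c x,
      \<lambda>d. if d \<in> A \<and> cinv c x \<in> cdom d then frechet_derivative (transition c d) (at x) y else 0)"

text \<open>The coordinate expression, in the induced coordinates (x, y), of a function on the
  tangent bundle.\<close>

definition local_rep ::
  "('m, 'n::finite) chart set \<Rightarrow> ('m, 'n) chart \<Rightarrow> (('m, 'n) tangent \<Rightarrow> real)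
    \<Rightarrow> (real ^ 'n) \<times> (real ^ 'n) \<Rightarrow> real" where
  "local_rep A c f = (\<lambda>(x, y). f (tangent_vec A c x y))"

text \<open>The induced coordinates of the nonzero tangent vectors over U.\<close>

definition slit_coords :: "('m, 'n::finite) chart \<Rightarrow> 'm set \<Rightarrow> ((real ^ 'n) \<times> (real ^ 'n)) set" where
  "slit_coords c U = (cmap c ` (cdom c \<inter> U)) \<times> (- {0})"

lemma transition_self:
  assumes "x \<in> cmap c ` cdom c"
  shows "transition c c x = x"
  using assms by (simp add: transition_def f_inv_into_f)

lemma smooth_manifold_inj_on:
  assumes "smooth_manifold X A" "c \<in> A"
  shows "inj_on (cmap c) (cdom c)"
proof -
  have "homeomorphic_map (subtopology X (cdom c)) (top_of_set (cmap c ` cdom c)) (cmap c)"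
    and "openin X (cdom c)"
    using assms by (auto simp: smooth_manifold_def)
  then show ?thesis
    by (metis homeomorphic_imp_injective_map inf.absorb2 openin_subset topspace_subtopology)
qed

lemma smooth_manifold_open_overlap:
  assumes M: "smooth_manifold X A" "c \<in> A" and U: "openin X U"
  shows "open (cmap c ` (cdom c \<inter> U))"
proof -
  have h: "homeomorphic_map (subtopology X (cdom c)) (top_of_set (cmap c ` cdom c)) (cmap c)"
    and o: "open (cmap c ` cdom c)"
    using M by (auto simp: smooth_manifold_def)
  have "openin (subtopology X (cdom c)) (cdom c \<inter> U)"
    using U by (auto simp: openin_subtopology)
  then have "openin (top_of_set (cmap c ` cdom c)) (cmap c ` (cdom c \<inter> U))"
    using h by (meson homeomorphic_imp_open_map open_map_def)
  then show ?thesis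
    using o openin_open_trans by blast
qed

lemma transition_differentiable:
  assumes M: "smooth_manifold X A" "c \<in> A" "d \<in> A" and x: "x \<in> cmap c ` (cdom c \<inter> cdom d)"
  shows "transition c d differentiable (at x)"
proof -
  have "smooth_on (cmap c ` (cdom c \<inter> cdom d)) (transition c d)"
    using M by (auto simp: smooth_manifold_def)
  then have "Ck_on (Suc 0) (cmap c ` (cdom c \<inter> cdom d)) (transition c d)"
    unfolding smooth_on_def by blast
  then show ?thesis using x by auto
qed

lemma snd_tangent_vec_self:
  assumes M: "smooth_manifold X A" "c \<in> A" and x: "x \<in> cmap c ` cdom c"
  shows "snd (tangent_vec A c x y) c = y"
proof -
  have o: "open (cmap c ` cdom c)"
    using M by (auto simp: smooth_manifold_def)
  have "(transition c c has_derivative (\<lambda>x. x)) (at x)"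
    by (rule has_derivative_transform_within_open[OF has_derivative_ident o x])
      (simp add: transition_self)
  then have "frechet_derivative (transition c c) (at x) = (\<lambda>x. x)"
    by (simp add: frechet_derivative_at[symmetric])
  then show ?thesis
    using M(2) x by (simp add: tangent_vec_def inv_into_into)
qed

text \<open>Compatibility with the change of induced coordinates on the tangent bundle.\<close>

lemma tangent_vec_transition:
  assumes M: "smooth_manifold X A" "c \<in> A" "d \<in> A" and x: "x \<in> cmap c ` (cdom c \<inter> cdom d)"
  shows "tangent_vec A d (transition c d x) (frechet_derivative (transition c d) (at x) y)
    = tangent_vec A c x y"
proof -
  obtain p where p: "p \<in> cdom c" "p \<in> cdom d" "x = cmap c p"
    using x by auto
  have cx: "cinv c x = p"
    using smooth_manifold_inj_on[OF M(1,2)] p by simp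
  have dx: "cinv d (transition c d x) = p"
    using smooth_manifold_inj_on[OF M(1,3)] p cx by (simp add: transition_def)
  have "frechet_derivative (transition d e) (at (transition c d x))
          (frechet_derivative (transition c d) (at x) y)
        = frechet_derivative (transition c e) (at x) y"
    if e: "e \<in> A" "p \<in> cdom e" for e
  proof -
    let ?W = "cmap c ` (cdom c \<inter> (cdom d \<inter> cdom e))"
    have "openin X (cdom d \<inter> cdom e)"
      using M e by (auto simp: smooth_manifold_def)
    then have W: "open ?W"
      by (rule smooth_manifold_open_overlap[OF M(1,2)])
    have xW: "x \<in> ?W"
      using p e by auto
    have D1: "(transition c d has_derivative frechet_derivative (transition c d) (at x)) (at x)"
      using transition_differentiable[OF M x] frechet_derivative_works by blast
    have "transition c d x \<in> cmap d ` (cdom d \<inter> cdom e)"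
      using p e cx by (auto simp: transition_def)
    then have D2: "(transition d e has_derivative
        frechet_derivative (transition d e) (at (transition c d x))) (at (transition c d x))"
      using transition_differentiable[OF M(1,3) e(1)] frechet_derivative_works by blast
    have eq: "(transition d e \<circ> transition c d) z = transition c e z" if "z \<in> ?W" for z
      using that smooth_manifold_inj_on[OF M(1,2)] smooth_manifold_inj_on[OF M(1,3)]
      by (auto simp: transition_def)
    have "(transition c e has_derivative
        frechet_derivative (transition d e) (at (transition c d x)) \<circ>
        frechet_derivative (transition c d) (at x)) (at x)"
      by (rule has_derivative_transform_within_open[OF diff_chain_at[OF D1 D2] W xW eq])
    then show ?thesis
      by (simp add: frechet_derivative_at[symmetric])
  qed
  then show ?thesis
    by (auto simp: tangent_vec_def cx dx)
qed


section \<open>Partial derivatives in induced coordinates\<close>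

definition dx :: "'n::finite \<Rightarrow> ((real ^ 'n) \<times> (real ^ 'n) \<Rightarrow> real) \<Rightarrow> (real ^ 'n) \<times> (real ^ 'n) \<Rightarrow> real" where
  "dx i f = (\<lambda>v. frechet_derivative f (at v) (axis i 1, 0))"

definition dy :: "'n::finite \<Rightarrow> ((real ^ 'n) \<times> (real ^ 'n) \<Rightarrow> real) \<Rightarrow> (real ^ 'n) \<times> (real ^ 'n) \<Rightarrow> real" where
  "dy i f = (\<lambda>v. frechet_derivative f (at v) (0, axis i 1))"


section \<open>Finsler functions and their geodesic sprays\<close>

definition metric_tensor :: "((real ^ 'n::finite) \<times> (real ^ 'n) \<Rightarrow> real) \<Rightarrow> (real ^ 'n) \<times> (real ^ 'n)
    \<Rightarrow> real ^ 'n ^ 'n" where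
  "metric_tensor f v = (\<chi> i j. dy i (dy j (\<lambda>w. (f w)\<^sup>2 / 2)) v)"

text \<open>Finsler functions on (the tangent bundle of) an open subset U of the manifold. The
  matrix g need not be assumed positive definite, only of full rank.\<close>

definition finsler_on ::
  "('m, 'n::finite) chart set \<Rightarrow> 'm set \<Rightarrow> (('m, 'n) tangent \<Rightarrow> real) \<Rightarrow> bool" where
  "finsler_on A U F \<longleftrightarrow>
     (\<forall>c\<in>A.
        smooth_on (slit_coords c U) (local_rep A c F) \<and>
        (\<forall>v\<in>slit_coords c U. local_rep A c F v > 0) \<and>
        (\<forall>x\<in>cmap c ` (cdom c \<inter> U). \<forall>y. \<forall>t>0.
           local_rep A c F (x, t *\<^sub>R y) = t * local_rep A c F (x, y)) \<and>
        (\<forall>v\<in>slit_coords c U. rank (metric_tensor (local_rep A c F) v) = CARD('n)))"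

text \<open>The coefficients G^i of the geodesic spray of the Finsler function with coordinate
  expression f.\<close>

definition spray_coeff :: "((real ^ 'n::finite) \<times> (real ^ 'n) \<Rightarrow> real) \<Rightarrow> 'n
    \<Rightarrow> (real ^ 'n) \<times> (real ^ 'n) \<Rightarrow> real" where
  "spray_coeff f i v =
     1/4 * (\<Sum>l\<in>UNIV. matrix_inv (metric_tensor f v) $ i $ l *
       ((\<Sum>k\<in>UNIV. snd v $ k * dx k (dy l (\<lambda>w. (f w)\<^sup>2)) v) - dx l (\<lambda>w. (f w)\<^sup>2) v))"

text \<open>A spray is given by its components, as a vector field on the slit tangent bundle, in the
  induced coordinates of each chart: the vector field y^j d/dx^j - 2 G^j d/dy^j has the
  components (y, - 2 G).\<close>

type_synonym ('m, 'n) spray =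
  "('m, 'n) chart \<Rightarrow> (real ^ 'n) \<times> (real ^ 'n) \<Rightarrow> (real ^ 'n) \<times> (real ^ 'n)"

definition geodesic_spray ::
  "('m, 'n::finite) chart set \<Rightarrow> (('m, 'n) tangent \<Rightarrow> real) \<Rightarrow> ('m, 'n) spray" where
  "geodesic_spray A F = (\<lambda>c v. (snd v, \<chi> i. - 2 * spray_coeff (local_rep A c F) i v))"


section \<open>Landsberg spaces\<close>

text \<open>G^h_ij and G^h_ijk\<close>

definition berwald_conn :: "((real ^ 'n::finite) \<times> (real ^ 'n) \<Rightarrow> real) \<Rightarrow> 'n \<Rightarrow> 'n \<Rightarrow> 'n
    \<Rightarrow> (real ^ 'n) \<times> (real ^ 'n) \<Rightarrow> real" where
  "berwald_conn f h i j = dy i (dy j (spray_coeff f h))"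

definition berwald_curv :: "((real ^ 'n::finite) \<times> (real ^ 'n) \<Rightarrow> real) \<Rightarrow> 'n \<Rightarrow> 'n \<Rightarrow> 'n \<Rightarrow> 'n
    \<Rightarrow> (real ^ 'n) \<times> (real ^ 'n) \<Rightarrow> real" where
  "berwald_curv f h i j k = dy k (berwald_conn f h i j)"

definition landsberg_curv :: "((real ^ 'n::finite) \<times> (real ^ 'n) \<Rightarrow> real) \<Rightarrow> 'n \<Rightarrow> 'n \<Rightarrow> 'n
    \<Rightarrow> (real ^ 'n) \<times> (real ^ 'n) \<Rightarrow> real" where
  "landsberg_curv f i j k v = - 1/2 * f v * (\<Sum>h\<in>UNIV. berwald_curv f h i j k v * dy h f v)"

definition landsberg_space ::
  "'m topology \<Rightarrow> ('m, 'n::finite) chart set \<Rightarrow> (('m, 'n) tangent \<Rightarrow> real) \<Rightarrow> bool" where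
  "landsberg_space X A F \<longleftrightarrow>
     finsler_on A (topspace X) F \<and>
     (\<forall>c\<in>A. \<forall>v\<in>slit_coords c (topspace X). \<forall>i j k. landsberg_curv (local_rep A c F) i j k v = 0)"


section \<open>Parallel 1-forms\<close>

text \<open>A 1-form is regarded as the fibrewise linear function b_i(x) y^i on the tangent bundle.\<close>

definition form_coeff ::
  "('m, 'n::finite) chart set \<Rightarrow> ('m, 'n) chart \<Rightarrow> (('m, 'n) tangent \<Rightarrow> real) \<Rightarrow> 'n
    \<Rightarrow> real ^ 'n \<Rightarrow> real" where
  "form_coeff A c \<beta> i x = local_rep A c \<beta> (x, axis i 1)"

definition one_form ::
  "('m, 'n::finite) chart set \<Rightarrow> (('m, 'n) tangent \<Rightarrow> real) \<Rightarrow> bool" where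
  "one_form A \<beta> \<longleftrightarrow>
     (\<forall>c\<in>A.
        (\<forall>i. smooth_on (cmap c ` cdom c) (form_coeff A c \<beta> i)) \<and>
        (\<forall>x\<in>cmap c ` cdom c. \<forall>y.
           local_rep A c \<beta> (x, y) = (\<Sum>i\<in>UNIV. form_coeff A c \<beta> i x * y $ i)))"

definition parallel_form ::
  "'m topology \<Rightarrow> ('m, 'n::finite) chart set \<Rightarrow> (('m, 'n) tangent \<Rightarrow> real)
    \<Rightarrow> (('m, 'n) tangent \<Rightarrow> real) \<Rightarrow> bool" where
  "parallel_form X A F \<beta> \<longleftrightarrow>
     one_form A \<beta> \<and>
     (\<forall>c\<in>A. \<forall>(x, y)\<in>slit_coords c (topspace X). \<forall>i j.
        frechet_derivative (form_coeff A c \<beta> i) (at x) (axis j 1)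
        - (\<Sum>h\<in>UNIV. berwald_conn (local_rep A c F) h i j (x, y) * form_coeff A c \<beta> h x) = 0)"

text \<open>Manifolds are not assumed to be connected, so a nonzero form is one that does not vanish
  identically on any connected component. This holds for every nowhere vanishing form, and it
  means that the form is not identically zero if the manifold is connected and nonempty.\<close>

definition nonzero_form ::
  "'m topology \<Rightarrow> ('m, 'n::finite) chart set \<Rightarrow> (('m, 'n) tangent \<Rightarrow> real) \<Rightarrow> bool" where
  "nonzero_form X A \<beta> \<longleftrightarrow>
     (\<forall>K\<in>connected_components_of X. \<exists>p\<in>K. \<exists>c\<in>A. p \<in> cdom c \<and>
        (\<exists>y. local_rep A c \<beta> (cmap c p, y) \<noteq> 0))"


section \<open>Metrizability freedom\<close>

text \<open>The value of df1 wedge df2 at v on the pair (a, b) of vectors.\<close>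

definition wedge_diff :: "((real ^ 'n::finite) \<times> (real ^ 'n) \<Rightarrow> real) \<Rightarrow> ((real ^ 'n) \<times> (real ^ 'n) \<Rightarrow> real)
    \<Rightarrow> (real ^ 'n) \<times> (real ^ 'n) \<Rightarrow> (real ^ 'n) \<times> (real ^ 'n) \<Rightarrow> (real ^ 'n) \<times> (real ^ 'n) \<Rightarrow> real" where
  "wedge_diff f1 f2 v a b =
     frechet_derivative f1 (at v) a * frechet_derivative f2 (at v) b
     - frechet_derivative f1 (at v) b * frechet_derivative f2 (at v) a"

text \<open>Functional independence is required on a dense (automatically open) set of nonzero tangent
  vectors over U. Two Finsler functions are never independent at all nonzero tangent vectors at
  a point: the quotient F2/F1 is homogeneous of degree 0 in y, so its restriction to the
  tangent space has a maximum, and there dF1 and dF2 are proportional along the fibre;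
  they are then proportional altogether if they have the same geodesic spray, because both
  vanish on horizontal vectors.\<close>

definition functionally_independent_on ::
  "('m, 'n::finite) chart set \<Rightarrow> 'm set \<Rightarrow> (('m, 'n) tangent \<Rightarrow> real)
    \<Rightarrow> (('m, 'n) tangent \<Rightarrow> real) \<Rightarrow> bool" where
  "functionally_independent_on A U F1 F2 \<longleftrightarrow>
     (\<forall>c\<in>A. slit_coords c U \<subseteq>
        closure {v \<in> slit_coords c U.
          \<exists>a b. wedge_diff (local_rep A c F1) (local_rep A c F2) v a b \<noteq> 0})"

definition metrizability_freedom_ge_2 ::
  "'m topology \<Rightarrow> ('m, 'n::finite) chart set \<Rightarrow> ('m, 'n) spray \<Rightarrow> bool" where
  "metrizability_freedom_ge_2 X A S \<longleftrightarrow>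
     (\<forall>p\<in>topspace X. \<exists>U F1 F2. openin X U \<and> p \<in> U \<and>
        finsler_on A U F1 \<and> finsler_on A U F2 \<and>
        (\<forall>c\<in>A. \<forall>v\<in>slit_coords c U.
           geodesic_spray A F1 c v = S c v \<and> geodesic_spray A F2 c v = S c v) \<and>
        functionally_independent_on A U F1 F2)"

end

theory Submission
  imports Defs
begin

text \<open>
The second Finsler function is a deformation of the given one by the parallel form,
\<open>sqrt (F\<^sup>2 + \<epsilon> \<beta>\<^sup>2)\<close> with a small constant \<open>\<epsilon> > 0\<close>. Write \<open>g\<close> for the metric tensor of \<open>F\<close>.

Same spray: since \<open>\<beta>\<close> is linear on the fibres, the metric tensor of the deformation is
\<open>g + \<epsilon> b b\<^sup>T\<close>, and the spray coefficients \<open>G\<close> of an energy are determined by \<open>4 g G = e\<close>, where \<open>e\<close>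
is the Euler-Lagrange expression of the squared Finsler function. It therefore suffices that \<open>\<beta>\<^sup>2\<close>
satisfies the Euler-Lagrange equation \<open>e(\<beta>\<^sup>2) = 4 b (b \<cdot> G)\<close> along the spray of \<open>F\<close>, which holds
because \<open>\<beta>\<close> is closed and constant along the spray. Both facts come out of one observation: at a fixed
point \<open>x\<close> the equation \<open>\<partial>\<^sub>j b\<^sub>i = G\<^sup>h\<^sub>i\<^sub>j b\<^sub>h\<close> says that the function \<open>b \<cdot> G(x, y)\<close> of \<open>y\<close>, homogeneous of
degree 2, has the constant Hessian \<open>\<partial>\<^sub>j b\<^sub>i\<close>, so by Euler's relation it is half the quadratic form of
this matrix, and comparing the gradients shows that the matrix is symmetric (lemmas
\<open>spray_dot_form_and_closed\<close>, \<open>euler_lagrange_form_squared\<close>, \<open>spray_deform\<close>).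

Nondegeneracy: \<open>g + \<epsilon> b b\<^sup>T\<close> is invertible as soon as \<open>1 + \<epsilon> \<bar>b\<bar>\<^sup>2 > 0\<close> for the norm defined by the
inverse of \<open>g\<close>. Nondegeneracy of \<open>g\<close> alone does not settle the sign of this norm, but the norm is
homogeneous of degree 0 in \<open>y\<close>, hence bounded over a compact neighbourhood, and a small \<open>\<epsilon>\<close> works there
in one chart
(\<open>exists_deformation_parameter\<close>). In the other charts the rank is the same, because the fibre Hessian
changes by an invertible linear map (\<open>rank_metric_tensor_linear_change\<close>).

Independence: the equation for \<open>b\<close> is a linear differential equation, so its zero set is
open and closed and a form that is nonzero on every component vanishes nowhere
(\<open>form_vanishes_near_zero\<close>, \<open>parallel_form_nowhere_zero\<close>). If \<open>F\<close> and its deformation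
were dependent near some vector of the fibre with \<open>\<beta> \<noteq> 0\<close>, then the derivative of \<open>F\<close> along a fixed
vector \<open>w \<noteq> 0\<close> of the kernel of \<open>b\<close>, which exists in dimension at least 2, would vanish there, and
\<open>w\<close> would lie in the kernel of \<open>g\<close> (\<open>functionally_independent_deform\<close>).
\<close>

section \<open>Closure properties of smooth functions\<close>

lemma frechet_derivative_cong_open:
  assumes "open S" "x \<in> S" "\<And>z. z \<in> S \<Longrightarrow> f z = g z"
  shows "frechet_derivative f (at x) = frechet_derivative g (at x)"
proof -
  have "(f has_derivative D) (at x) \<longleftrightarrow> (g has_derivative D) (at x)" for D
    using has_derivative_transform_within_open[OF _ assms(1,2)] assms(3) by metis
  then show ?thesis by (simp add: frechet_derivative_def)
qed

lemma frechet_derivative_eqI: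
  assumes "(f has_derivative D) (at x)"
  shows "frechet_derivative f (at x) v = D v"
  using frechet_derivative_at[OF assms] by simp

lemma Ck_on_cong:
  assumes "open S" "\<And>x. x \<in> S \<Longrightarrow> f x = g x" "Ck_on k S f"
  shows "Ck_on k S g"
  using assms(2,3)
proof (induction k arbitrary: f g)
  case 0
  then show ?case by (simp cong: continuous_on_cong)
next
  case (Suc k)
  have "g differentiable (at x)" if "x \<in> S" for x
    using Suc.prems that has_derivative_transform_within_open[OF _ assms(1) that]
    unfolding differentiable_def by (metis Ck_on.simps(2) differentiable_def)
  moreover have "Ck_on k S (\<lambda>x. frechet_derivative g (at x) v)" for v
  proof (rule Suc.IH)
    show "Ck_on k S (\<lambda>x. frechet_derivative f (at x) v)" using Suc.prems by simp
    show "frechet_derivative f (at x) v = frechet_derivative g (at x) v" if "x \<in> S" for x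
      using frechet_derivative_cong_open[OF assms(1) that Suc.prems(1)] by simp
  qed
  ultimately show ?case by simp
qed

lemma Ck_on_SucI:
  assumes "open S" "\<And>x. x \<in> S \<Longrightarrow> (f has_derivative f' x) (at x)"
    and "\<And>v. Ck_on k S (\<lambda>x. f' x v)"
  shows "Ck_on (Suc k) S f"
proof -
  have "Ck_on k S (\<lambda>x. frechet_derivative f (at x) v)" for v
    by (rule Ck_on_cong[OF assms(1) _ assms(3)[of v]]) (simp add: frechet_derivative_eqI[OF assms(2)])
  then show ?thesis using assms(2) by (auto simp: differentiable_def)
qed

lemma Ck_on_SucD: "Ck_on (Suc k) S f \<Longrightarrow> Ck_on k S f"
proof (induction k arbitrary: f)
  case 0
  then show ?case
    by (auto intro!: differentiable_imp_continuous_on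
        simp: differentiable_on_def differentiable_at_withinI)
next
  case (Suc k)
  then show ?case by (metis Ck_on.simps(2))
qed

lemma Ck_on_const [intro]: "Ck_on k S (\<lambda>x. c)"
  by (induction k arbitrary: c) auto

lemma Ck_on_add:
  assumes "open S"
  shows "Ck_on k S f \<Longrightarrow> Ck_on k S g \<Longrightarrow> Ck_on k S (\<lambda>x. f x + g x)"
proof (induction k arbitrary: f g)
  case 0
  then show ?case by (simp add: continuous_on_add)
next
  case (Suc k)
  show ?case
  proof (rule Ck_on_SucI[OF assms])
    show "((\<lambda>x. f x + g x) has_derivative
        (\<lambda>v. frechet_derivative f (at x) v + frechet_derivative g (at x) v)) (at x)"
      if "x \<in> S" for x
      using Suc.prems that frechet_derivative_works by (auto intro!: has_derivative_add)
  qed (use Suc in auto)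
qed

lemma Ck_on_mult:
  fixes f g :: "'a::euclidean_space \<Rightarrow> real"
  assumes "open S"
  shows "Ck_on k S f \<Longrightarrow> Ck_on k S g \<Longrightarrow> Ck_on k S (\<lambda>x. f x * g x)"
proof (induction k arbitrary: f g)
  case 0
  then show ?case by (simp add: continuous_on_mult)
next
  case (Suc k)
  show ?case
  proof (rule Ck_on_SucI[OF assms])
    show "((\<lambda>x. f x * g x) has_derivative
        (\<lambda>v. f x * frechet_derivative g (at x) v + frechet_derivative f (at x) v * g x)) (at x)"
      if "x \<in> S" for x
      using Suc.prems that frechet_derivative_works by (auto intro!: has_derivative_mult)
    show "Ck_on k S (\<lambda>x. f x * frechet_derivative g (at x) v + frechet_derivative f (at x) v * g x)"
      for v
      using Suc.prems Ck_on_SucD[OF Suc.prems(1)] Ck_on_SucD[OF Suc.prems(2)]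
      by (intro Ck_on_add[OF assms] Suc.IH) auto
  qed
qed

text \<open>The statement is for all exponents at once: the derivative lowers the exponent by one, so
the induction over the order of differentiability has to let it vary.\<close>

lemma Ck_on_powr:
  fixes f :: "'a::euclidean_space \<Rightarrow> real"
  assumes "open S" and pos: "\<And>x. x \<in> S \<Longrightarrow> f x > 0"
  shows "Ck_on k S f \<Longrightarrow> Ck_on k S (\<lambda>x. f x powr p)"
proof (induction k arbitrary: p)
  case 0
  then show ?case using pos by (fastforce intro!: continuous_intros)
next
  case (Suc k)
  show ?case
  proof (rule Ck_on_SucI[OF assms(1)])
    show "((\<lambda>x. f x powr p) has_derivative
        (\<lambda>v. p * f x powr (p - 1) * frechet_derivative f (at x) v)) (at x)" if "x \<in> S" for x
    proof -
      have "(f has_derivative frechet_derivative f (at x)) (at x)"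
        using Suc.prems that frechet_derivative_works by auto
      from has_derivative_powr[OF this has_derivative_const[of p] pos[OF that]]
      show ?thesis
        using pos[OF that] by (simp add: powr_diff field_simps)
    qed
    show "Ck_on k S (\<lambda>x. p * f x powr (p - 1) * frechet_derivative f (at x) v)" for v
      using Suc.prems Ck_on_SucD[OF Suc.prems]
      by (intro Ck_on_mult[OF assms(1)] Suc.IH) auto
  qed
qed

lemma Ck_on_linear:
  assumes "open S" "bounded_linear f"
  shows "Ck_on k S f"
proof (cases k)
  case 0
  then show ?thesis using assms(2) by (simp add: linear_continuous_on)
next
  case (Suc m)
  have "Ck_on (Suc m) S f"
    by (rule Ck_on_SucI[OF assms(1), where f' = "\<lambda>x. f"])
      (use assms(2) bounded_linear_imp_has_derivative in auto)
  then show ?thesis using Suc by simp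
qed

lemma Ck_on_comp_fst:
  fixes f :: "'a::euclidean_space \<Rightarrow> real"
  assumes "open D"
  shows "Ck_on k D f \<Longrightarrow> Ck_on k (D \<times> (UNIV :: 'b::euclidean_space set)) (\<lambda>v. f (fst v))"
proof (induction k arbitrary: f)
  case 0
  then show ?case
    by (auto intro!: continuous_intros continuous_on_compose2[of D f])
next
  case (Suc k)
  show ?case
  proof (rule Ck_on_SucI)
    show "((\<lambda>v. f (fst v)) has_derivative
        (\<lambda>w. frechet_derivative f (at (fst v)) (fst w))) (at v)" if "v \<in> D \<times> UNIV" for v :: "'a \<times> 'b"
    proof -
      have "(f has_derivative frechet_derivative f (at (fst v))) (at (fst v))"
        using Suc.prems that by (auto simp flip: frechet_derivative_works)
      from diff_chain_at[OF has_derivative_fst[OF has_derivative_ident] this]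
      show ?thesis by (simp add: o_def)
    qed
  qed (use assms Suc in \<open>auto intro!: open_Times\<close>)
qed

lemma Ck_on_subset: "Ck_on k S f \<Longrightarrow> T \<subseteq> S \<Longrightarrow> Ck_on k T f"
  by (induction k arbitrary: f) (auto intro: continuous_on_subset)

lemma smooth_on_subset: "smooth_on S f \<Longrightarrow> T \<subseteq> S \<Longrightarrow> smooth_on T f"
  unfolding smooth_on_def using Ck_on_subset by blast

lemma smooth_on_cong:
  "open S \<Longrightarrow> smooth_on S f \<Longrightarrow> (\<And>x. x \<in> S \<Longrightarrow> f x = g x) \<Longrightarrow> smooth_on S g"
  unfolding smooth_on_def using Ck_on_cong by blast

lemma smooth_on_const: "smooth_on S (\<lambda>x. c)"
  by (auto simp: smooth_on_def)

lemma smooth_on_add: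
  "open S \<Longrightarrow> smooth_on S f \<Longrightarrow> smooth_on S g \<Longrightarrow> smooth_on S (\<lambda>x. f x + g x)"
  by (simp add: smooth_on_def Ck_on_add)

lemma smooth_on_mult:
  fixes f g :: "'a::euclidean_space \<Rightarrow> real"
  shows "open S \<Longrightarrow> smooth_on S f \<Longrightarrow> smooth_on S g \<Longrightarrow> smooth_on S (\<lambda>x. f x * g x)"
  by (simp add: smooth_on_def Ck_on_mult)

lemma smooth_on_diff:
  fixes f g :: "'a::euclidean_space \<Rightarrow> real"
  assumes "open S" "smooth_on S f" "smooth_on S g"
  shows "smooth_on S (\<lambda>x. f x - g x)"
  using smooth_on_add[OF assms(1,2) smooth_on_mult[OF assms(1) smooth_on_const[of _ "-1"] assms(3)]]
  by simp

lemma smooth_on_power2: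
  fixes f :: "'a::euclidean_space \<Rightarrow> real"
  shows "open S \<Longrightarrow> smooth_on S f \<Longrightarrow> smooth_on S (\<lambda>x. (f x)\<^sup>2)"
  by (simp add: power2_eq_square smooth_on_mult)

lemma smooth_on_powr:
  fixes f :: "'a::euclidean_space \<Rightarrow> real"
  shows "open S \<Longrightarrow> smooth_on S f \<Longrightarrow> (\<And>x. x \<in> S \<Longrightarrow> f x > 0) \<Longrightarrow> smooth_on S (\<lambda>x. f x powr p)"
  by (simp add: smooth_on_def Ck_on_powr)

lemma smooth_on_sqrt:
  fixes f :: "'a::euclidean_space \<Rightarrow> real"
  assumes "open S" "smooth_on S f" "\<And>x. x \<in> S \<Longrightarrow> f x > 0"
  shows "smooth_on S (\<lambda>x. sqrt (f x))"
  using smooth_on_cong[OF assms(1) smooth_on_powr[OF assms, of "1/2"]] assms(3)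
  by (simp add: powr_half_sqrt less_imp_le)

lemma smooth_on_divide:
  fixes f g :: "'a::euclidean_space \<Rightarrow> real"
  assumes S: "open S" and f: "smooth_on S f" and g: "smooth_on S g"
    and nz: "\<And>x. x \<in> S \<Longrightarrow> g x \<noteq> 0"
  shows "smooth_on S (\<lambda>x. f x / g x)"
proof -
  \<comment> \<open>\<open>1/g = g (g^2) powr -1\<close> also where \<open>g\<close> is negative.\<close>
  have "smooth_on S (\<lambda>x. f x * (g x * (g x)\<^sup>2 powr (-1)))"
    by (intro smooth_on_mult smooth_on_powr smooth_on_power2 S f g) (use nz in auto)
  moreover have "f x * (g x * (g x)\<^sup>2 powr (-1)) = f x / g x" if "x \<in> S" for x
    using nz[OF that] by (simp add: powr_minus_divide power2_eq_square)
  ultimately show ?thesis by (rule smooth_on_cong[OF S])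
qed

lemma smooth_on_sum:
  assumes "open S" "\<And>i. i \<in> I \<Longrightarrow> smooth_on S (f i)"
  shows "smooth_on S (\<lambda>x. \<Sum>i\<in>I. f i x)"
  using assms(2)
  by (induction I rule: infinite_finite_induct) (auto intro: smooth_on_const smooth_on_add[OF assms(1)])

lemma smooth_on_prod:
  fixes f :: "'i \<Rightarrow> 'a::euclidean_space \<Rightarrow> real"
  assumes "open S" "\<And>i. i \<in> I \<Longrightarrow> smooth_on S (f i)"
  shows "smooth_on S (\<lambda>x. \<Prod>i\<in>I. f i x)"
  using assms(2)
  by (induction I rule: infinite_finite_induct) (auto intro: smooth_on_const smooth_on_mult[OF assms(1)])

lemma smooth_on_linear: "open S \<Longrightarrow> bounded_linear f \<Longrightarrow> smooth_on S f"
  by (simp add: smooth_on_def Ck_on_linear)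

lemma smooth_on_comp_fst:
  fixes f :: "'a::euclidean_space \<Rightarrow> real"
  assumes "open D" "smooth_on D f"
  shows "smooth_on (D \<times> (UNIV :: 'b::euclidean_space set)) (\<lambda>v. f (fst v))"
  using assms by (simp add: smooth_on_def Ck_on_comp_fst)

lemma smooth_on_continuous: "smooth_on S f \<Longrightarrow> continuous_on S f"
  unfolding smooth_on_def by (metis Ck_on.simps(1))

lemma smooth_on_has_derivative:
  "smooth_on S f \<Longrightarrow> x \<in> S \<Longrightarrow> (f has_derivative frechet_derivative f (at x)) (at x)"
  unfolding smooth_on_def by (metis Ck_on.simps(2) frechet_derivative_works)

lemma smooth_on_differentiable: "smooth_on S f \<Longrightarrow> x \<in> S \<Longrightarrow> f differentiable (at x)"
  unfolding smooth_on_def by (metis Ck_on.simps(2))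

lemma smooth_on_frechet_derivative:
  "smooth_on S f \<Longrightarrow> smooth_on S (\<lambda>x. frechet_derivative f (at x) v)"
  unfolding smooth_on_def by (metis Ck_on.simps(2))

lemma smooth_on_det:
  fixes M :: "'a::euclidean_space \<Rightarrow> real ^ 'n ^ 'n"
  assumes "open S" "\<And>i j. smooth_on S (\<lambda>x. M x $ i $ j)"
  shows "smooth_on S (\<lambda>x. det (M x))"
  unfolding det_def
  by (intro smooth_on_sum smooth_on_mult smooth_on_const smooth_on_prod assms)

section \<open>Smooth dependence of solutions of linear equations\<close>

lemma det_nz_iff_full_rank:
  fixes M :: "real ^ 'n ^ 'n"
  shows "det M \<noteq> 0 \<longleftrightarrow> rank M = CARD('n)"
  using rank_bound[of M] by (auto simp: det_eq_0_rank)

lemma matrix_inv_mult_vec_unique: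
  fixes M :: "real ^ 'n ^ 'n"
  assumes "rank M = CARD('n)"
  shows "matrix_inv M *v u = w \<longleftrightarrow> M *v w = u"
proof -
  have "invertible M" using assms det_nz_iff_full_rank invertible_det_nz by blast
  then have "matrix_inv M ** M = mat 1" "M ** matrix_inv M = mat 1"
    unfolding invertible_def matrix_inv_def by (auto dest!: someI_ex)
  then show ?thesis by (metis matrix_vector_mul_assoc matrix_vector_mul_lid)
qed

text \<open>By Cramer's rule the entries of the solution are quotients of determinants, which are
polynomials in the entries of the matrix and the right-hand side.\<close>

lemma smooth_on_matrix_inv_mult_vec:
  fixes M :: "'a::euclidean_space \<Rightarrow> real ^ 'n ^ 'n"
  assumes S: "open S" and M: "\<And>i j. smooth_on S (\<lambda>x. M x $ i $ j)"
    and e: "\<And>i. smooth_on S (\<lambda>x. e x $ i)"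
    and rank: "\<And>x. x \<in> S \<Longrightarrow> rank (M x) = CARD('n)"
  shows "smooth_on S (\<lambda>x. (matrix_inv (M x) *v e x) $ k)"
proof -
  have "smooth_on S (\<lambda>x. det (\<chi> i j. if j = k then e x $ i else M x $ i $ j) / det (M x))"
  proof (intro smooth_on_divide smooth_on_det S M)
    show "smooth_on S (\<lambda>x. (\<chi> i j. if j = k then e x $ i else M x $ i $ j) $ i $ j)" for i j
      using e M by (cases "j = k") auto
  qed (use rank det_nz_iff_full_rank in blast)
  moreover have "det (\<chi> i j. if j = k then e x $ i else M x $ i $ j) / det (M x)
      = (matrix_inv (M x) *v e x) $ k" if "x \<in> S" for x
  proof -
    have nz: "det (M x) \<noteq> 0" using rank[OF that] det_nz_iff_full_rank by blast
    have "M x *v (matrix_inv (M x) *v e x) = e x"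
      using matrix_inv_mult_vec_unique[OF rank[OF that]] by blast
    from cramer[OF nz, THEN iffD1, OF this] show ?thesis
      by (metis (no_types, lifting) vec_lambda_beta)
  qed
  ultimately show ?thesis by (rule smooth_on_cong[OF S])
qed

section \<open>Derivatives along the fibres\<close>

definition fibre_deriv ::
  "real ^ 'n::finite \<Rightarrow> ((real ^ 'n) \<times> (real ^ 'n) \<Rightarrow> real) \<Rightarrow> (real ^ 'n) \<times> (real ^ 'n) \<Rightarrow> real" where
  "fibre_deriv u q = (\<lambda>v. frechet_derivative q (at v) (0, u))"

lemma dy_eq_fibre_deriv: "dy i = fibre_deriv (axis i 1)"
  by (simp add: fun_eq_iff dy_def fibre_deriv_def)

lemma smooth_on_fibre_deriv: "smooth_on S q \<Longrightarrow> smooth_on S (fibre_deriv u q)"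
  unfolding fibre_deriv_def by (rule smooth_on_frechet_derivative)

lemma smooth_on_dy: "smooth_on S q \<Longrightarrow> smooth_on S (dy i q)"
  unfolding dy_def by (rule smooth_on_frechet_derivative)

lemma smooth_on_dx: "smooth_on S q \<Longrightarrow> smooth_on S (dx i q)"
  unfolding dx_def by (rule smooth_on_frechet_derivative)

lemma fibre_deriv_cong:
  assumes "open S" "v \<in> S" "\<And>z. z \<in> S \<Longrightarrow> f z = g z"
  shows "fibre_deriv u f v = fibre_deriv u g v"
  using frechet_derivative_cong_open[OF assms] by (simp add: fibre_deriv_def)

lemma dx_cong:
  assumes "open S" "v \<in> S" "\<And>z. z \<in> S \<Longrightarrow> f z = g z"
  shows "dx i f v = dx i g v"
  using frechet_derivative_cong_open[OF assms] by (simp add: dx_def)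

lemma fibre_deriv_eq_sum:
  fixes q :: "(real ^ 'n::finite) \<times> (real ^ 'n) \<Rightarrow> real"
  assumes "q differentiable (at v)"
  shows "fibre_deriv u q v = (\<Sum>i\<in>UNIV. u $ i * dy i q v)"
proof -
  interpret linear "frechet_derivative q (at v)"
    using assms by (rule linear_frechet_derivative)
  have "(0, u) = (\<Sum>i\<in>UNIV. u $ i *\<^sub>R (0 :: real ^ 'n, axis i (1 :: real)))"
    by (simp add: prod_eq_iff fst_sum snd_sum basis_expansion scalar_mult_eq_scaleR flip: scalar_mult_eq_scaleR)
  then have "frechet_derivative q (at v) (0, u)
      = frechet_derivative q (at v) (\<Sum>i\<in>UNIV. u $ i *\<^sub>R (0 :: real ^ 'n, axis i (1 :: real)))"
    by (rule arg_cong)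
  then show ?thesis unfolding fibre_deriv_def dy_def sum scale real_scaleR_def .
qed

lemma has_derivative_along_fibre:
  assumes "q differentiable (at (x, y))"
  shows "((\<lambda>z. q (x, z)) has_derivative (\<lambda>u. fibre_deriv u q (x, y))) (at y)"
proof -
  have "(q has_derivative frechet_derivative q (at (x, y))) (at (x, y))"
    using assms frechet_derivative_works by blast
  moreover have "((\<lambda>z. (x, z)) has_derivative (\<lambda>u. (0, u))) (at y)"
    by (auto intro!: derivative_eq_intros)
  ultimately show ?thesis
    using diff_chain_at[of "\<lambda>z. (x, z)" _ y q] by (simp add: o_def fibre_deriv_def)
qed

text \<open>A derivative along the fibre is determined by the restriction to that fibre.\<close>

lemma fibre_deriv_eqI:
  assumes "q differentiable (at (x, y))" "((\<lambda>z. q (x, z)) has_derivative D) (at y)"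
  shows "fibre_deriv u q (x, y) = D u"
  using has_derivative_unique[OF has_derivative_along_fibre[OF assms(1)] assms(2)] by meson

lemma fibre_deriv_sum:
  assumes "\<And>j. j \<in> J \<Longrightarrow> g j differentiable (at v)"
  shows "fibre_deriv u (\<lambda>z. \<Sum>j\<in>J. c j * g j z) v = (\<Sum>j\<in>J. c j * fibre_deriv u (g j) v)"
proof -
  have "((\<lambda>z. \<Sum>j\<in>J. c j * g j z) has_derivative
      (\<lambda>h. \<Sum>j\<in>J. c j * frechet_derivative (g j) (at v) h)) (at v)"
    using assms frechet_derivative_works
    by (intro has_derivative_sum has_derivative_mult_right) blast
  then show ?thesis by (simp add: fibre_deriv_def frechet_derivative_eqI)
qed

lemma second_fibre_deriv_eq_sum:
  fixes q :: "(real ^ 'n::finite) \<times> (real ^ 'n) \<Rightarrow> real"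
  assumes "open S" "smooth_on S q" "v \<in> S"
  shows "fibre_deriv u (fibre_deriv w q) v = (\<Sum>i\<in>UNIV. u $ i * (\<Sum>j\<in>UNIV. w $ j * dy i (dy j q) v))"
proof -
  have "fibre_deriv u (fibre_deriv w q) v = (\<Sum>i\<in>UNIV. u $ i * dy i (fibre_deriv w q) v)"
    using assms by (intro fibre_deriv_eq_sum smooth_on_differentiable smooth_on_fibre_deriv)
  also have "\<dots> = (\<Sum>i\<in>UNIV. u $ i * (\<Sum>j\<in>UNIV. w $ j * dy i (dy j q) v))"
  proof (intro sum.cong refl arg_cong2[where f = "(*)"])
    fix i :: 'n
    show "dy i (fibre_deriv w q) v = (\<Sum>j\<in>UNIV. w $ j * dy i (dy j q) v)"
    proof -
      have "dy i (fibre_deriv w q) v = dy i (\<lambda>z. \<Sum>j\<in>UNIV. w $ j * dy j q z) v"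
        unfolding dy_eq_fibre_deriv[of i]
        by (rule fibre_deriv_cong[OF assms(1,3)])
          (simp add: fibre_deriv_eq_sum smooth_on_differentiable[OF assms(2)])
      then show ?thesis
        unfolding dy_eq_fibre_deriv[of i]
        using fibre_deriv_sum[of UNIV "\<lambda>j. dy j q" v] smooth_on_differentiable[OF smooth_on_dy[OF assms(2)] assms(3)]
        by simp
    qed
  qed
  finally show ?thesis .
qed

lemma metric_tensor_bilinear:
  assumes "open S" "smooth_on S f" "v \<in> S"
  shows "u \<bullet> (metric_tensor f v *v w) = fibre_deriv u (fibre_deriv w (\<lambda>z. (f z)\<^sup>2 / 2)) v"
proof -
  have "smooth_on S (\<lambda>z. (f z)\<^sup>2 / 2)"
    using smooth_on_mult[OF assms(1) smooth_on_const[of S "1/2"] smooth_on_power2[OF assms(1,2)]]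
    by simp
  from second_fibre_deriv_eq_sum[OF assms(1) this assms(3)] show ?thesis
    by (simp add: inner_vec_def matrix_vector_mult_def metric_tensor_def mult.commute)
qed

text \<open>A coordinate-free form of nondegeneracy: it refers to arbitrary fibre directions instead of
  the coordinate directions, so that it can be carried through linear changes of the fibre and
  tested on a single vector of the kernel.\<close>

lemma rank_metric_tensor_iff:
  fixes f :: "(real ^ 'n::finite) \<times> (real ^ 'n) \<Rightarrow> real"
  assumes "open S" "smooth_on S f" "v \<in> S"
  shows "rank (metric_tensor f v) = CARD('n) \<longleftrightarrow>
    (\<forall>w. (\<forall>u. fibre_deriv u (fibre_deriv w (\<lambda>z. (f z)\<^sup>2 / 2)) v = 0) \<longrightarrow> w = 0)"
proof -
  have "metric_tensor f v *v w = 0 \<longleftrightarrow>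
      (\<forall>u. fibre_deriv u (fibre_deriv w (\<lambda>z. (f z)\<^sup>2 / 2)) v = 0)" for w
    unfolding metric_tensor_bilinear[OF assms, symmetric] by (metis inner_eq_zero_iff inner_zero_right)
  then show ?thesis
    unfolding full_rank_injective
    by (simp add: linear_injective_0 matrix_vector_mul_linear)
qed

text \<open>Differentiate the homogeneity relation through the scaling of the fibre. The scaling
multiplies only the fibre direction by \<open>t\<close>, so a derivative along the fibre loses one degree and
one along the base keeps it.\<close>

lemma frechet_derivative_homogeneous:
  fixes q :: "(real ^ 'n::finite) \<times> (real ^ 'n) \<Rightarrow> real"
  assumes D: "open D" and q: "smooth_on (D \<times> - {0}) q"
    and hom: "\<And>x y. x \<in> D \<Longrightarrow> y \<noteq> 0 \<Longrightarrow> q (x, t *\<^sub>R y) = t ^ k * q (x, y)"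
    and x: "x \<in> D" "y \<noteq> 0" and t: "t > 0"
  shows "frechet_derivative q (at (x, t *\<^sub>R y)) (a, t *\<^sub>R u) = t ^ k * frechet_derivative q (at (x, y)) (a, u)"
proof -
  let ?s = "\<lambda>v :: (real ^ 'n) \<times> (real ^ 'n). (fst v, t *\<^sub>R snd v)"
  have o: "open (D \<times> - {0 :: real ^ 'n})" using D by (intro open_Times) auto
  have s: "(?s has_derivative ?s) (at (x, y))"
    by (auto intro!: derivative_eq_intros simp: case_prod_beta)
  have "(q has_derivative frechet_derivative q (at (?s (x, y)))) (at (?s (x, y)))"
    using x t by (intro smooth_on_has_derivative[OF q]) auto
  from diff_chain_at[OF s this]
  have "((\<lambda>v. q (?s v)) has_derivative (\<lambda>w. frechet_derivative q (at (x, t *\<^sub>R y)) (?s w))) (at (x, y))"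
    by (simp add: o_def)
  then have "((\<lambda>v. t ^ k * q v) has_derivative (\<lambda>w. frechet_derivative q (at (x, t *\<^sub>R y)) (?s w))) (at (x, y))"
  proof (rule has_derivative_transform_within_open[OF _ o])
    show "q (?s v) = t ^ k * q v" if "v \<in> D \<times> - {0}" for v
      using hom[of "fst v" "snd v"] that by (simp add: mem_Times_iff)
  qed (use x in auto)
  moreover have "((\<lambda>v. t ^ k * q v) has_derivative (\<lambda>w. t ^ k * frechet_derivative q (at (x, y)) w)) (at (x, y))"
    using x by (intro has_derivative_mult_right smooth_on_has_derivative[OF q]) auto
  ultimately have "(\<lambda>w. frechet_derivative q (at (x, t *\<^sub>R y)) (?s w))
      = (\<lambda>w. t ^ k * frechet_derivative q (at (x, y)) w)"
    by (rule has_derivative_unique)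
  from fun_cong[OF this, of "(a, u)"] show ?thesis by simp
qed

lemma dx_homogeneous:
  fixes q :: "(real ^ 'n::finite) \<times> (real ^ 'n) \<Rightarrow> real"
  assumes "open D" "smooth_on (D \<times> - {0}) q"
    and "\<And>x y. x \<in> D \<Longrightarrow> y \<noteq> 0 \<Longrightarrow> q (x, t *\<^sub>R y) = t ^ k * q (x, y)"
    and "x \<in> D" "y \<noteq> 0" "t > 0"
  shows "dx i q (x, t *\<^sub>R y) = t ^ k * dx i q (x, y)"
  using frechet_derivative_homogeneous[OF assms, of "axis i 1" 0] by (simp add: dx_def)

lemma fibre_deriv_homogeneous:
  fixes q :: "(real ^ 'n::finite) \<times> (real ^ 'n) \<Rightarrow> real"
  assumes "open D" "smooth_on (D \<times> - {0}) q"
    and "\<And>x y. x \<in> D \<Longrightarrow> y \<noteq> 0 \<Longrightarrow> q (x, t *\<^sub>R y) = t ^ Suc k * q (x, y)"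
    and "x \<in> D" "y \<noteq> 0" "t > 0"
  shows "fibre_deriv u q (x, t *\<^sub>R y) = t ^ k * fibre_deriv u q (x, y)"
proof -
  have "linear (frechet_derivative q (at (x, t *\<^sub>R y)))"
    using assms by (intro linear_frechet_derivative smooth_on_differentiable[OF assms(2)]) auto
  then have "t * fibre_deriv u q (x, t *\<^sub>R y) = frechet_derivative q (at (x, t *\<^sub>R y)) (0, t *\<^sub>R u)"
    using linear_cmul[of "frechet_derivative q (at (x, t *\<^sub>R y))" t "(0, u)"]
    by (simp add: fibre_deriv_def)
  also have "\<dots> = t * (t ^ k * fibre_deriv u q (x, y))"
    using frechet_derivative_homogeneous[OF assms, of 0 u] by (simp add: fibre_deriv_def mult.assoc)
  finally show ?thesis using assms(6) by simp
qed

lemma euler_homogeneous: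
  fixes q :: "(real ^ 'n::finite) \<times> (real ^ 'n) \<Rightarrow> real"
  assumes "q differentiable (at (x, y))"
    and hom: "\<And>t. t > 0 \<Longrightarrow> q (x, t *\<^sub>R y) = t ^ k * q (x, y)"
  shows "fibre_deriv y q (x, y) = real k * q (x, y)"
proof -
  have "((\<lambda>t. t *\<^sub>R y) has_derivative (\<lambda>t. t *\<^sub>R y)) (at (1::real))"
    by (auto intro!: derivative_eq_intros)
  from diff_chain_at[OF this, of "\<lambda>z. q (x, z)" "\<lambda>u. fibre_deriv u q (x, y)"]
  have "((\<lambda>t. q (x, t *\<^sub>R y)) has_derivative (\<lambda>t. fibre_deriv (t *\<^sub>R y) q (x, y))) (at 1)"
    using has_derivative_along_fibre[OF assms(1)] by (simp add: o_def)
  then have "((\<lambda>t. t ^ k * q (x, y)) has_derivative (\<lambda>t. fibre_deriv (t *\<^sub>R y) q (x, y))) (at 1)"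
    by (rule has_derivative_transform_within_open[where s = "{0<..}"]) (use hom in auto)
  moreover have "((\<lambda>t. t ^ k * q (x, y)) has_derivative (\<lambda>t. real k * t * q (x, y))) (at 1)"
    by (auto intro!: derivative_eq_intros)
  ultimately have "(\<lambda>t. fibre_deriv (t *\<^sub>R y) q (x, y)) = (\<lambda>t. real k * t * q (x, y))"
    by (rule has_derivative_unique)
  from fun_cong[OF this, of 1] show ?thesis by simp
qed

lemma sum_axis [simp]:
  fixes g :: "'n::finite \<Rightarrow> real"
  shows "(\<Sum>j\<in>UNIV. axis i 1 $ j * g j) = g i" "(\<Sum>j\<in>UNIV. g j * axis i 1 $ j) = g i"
  by (simp_all add: axis_def if_distrib[of "\<lambda>t. t * _"] if_distrib[of "\<lambda>t. _ * t"] cong: if_cong)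

lemma fibre_deriv_linear_change:
  fixes L :: "real ^ 'n::finite \<Rightarrow> real ^ 'n"
  assumes "q differentiable (at (x, y))" "p differentiable (at (X, L y))" "linear L" "y \<noteq> 0"
    and "\<And>z. z \<noteq> 0 \<Longrightarrow> q (x, z) = p (X, L z)"
  shows "fibre_deriv u q (x, y) = fibre_deriv (L u) p (X, L y)"
proof (rule fibre_deriv_eqI[OF assms(1)])
  have "(L has_derivative L) (at y)"
    using assms(3) linear_imp_has_derivative by blast
  from diff_chain_at[OF this has_derivative_along_fibre[OF assms(2)]]
  have "((\<lambda>z. p (X, L z)) has_derivative (\<lambda>u. fibre_deriv (L u) p (X, L y))) (at y)"
    by (simp add: o_def)
  then show "((\<lambda>z. q (x, z)) has_derivative (\<lambda>u. fibre_deriv (L u) p (X, L y))) (at y)"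
    by (rule has_derivative_transform_within_open[where s = "- {0}"]) (use assms in auto)
qed

text \<open>On a fibre, a change of charts is an invertible linear map, and the second fibre derivative
transforms as a bilinear form under it.\<close>

lemma rank_metric_tensor_linear_change:
  fixes L :: "real ^ 'n::finite \<Rightarrow> real ^ 'n"
  assumes S: "open S" "smooth_on S q" "\<And>z. z \<noteq> 0 \<Longrightarrow> (x, z) \<in> S"
    and T: "open T" "smooth_on T p" "\<And>z. z \<noteq> 0 \<Longrightarrow> (X, z) \<in> T"
    and L: "linear L" "inj L" and y: "y \<noteq> 0"
    and qp: "\<And>z. z \<noteq> 0 \<Longrightarrow> q (x, z) = p (X, L z)"
    and rank: "rank (metric_tensor p (X, L y)) = CARD('n)"
  shows "rank (metric_tensor q (x, y)) = CARD('n)"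
proof -
  let ?Q = "\<lambda>v. (q v)\<^sup>2 / 2" and ?P = "\<lambda>v. (p v)\<^sup>2 / 2"
  have L0: "L z \<noteq> 0" if "z \<noteq> 0" for z
    using that L linear_injective_0 by blast
  have sQ: "smooth_on S ?Q" and sP: "smooth_on T ?P"
    using smooth_on_mult[OF S(1) smooth_on_const[of _ "1/2"] smooth_on_power2[OF S(1,2)]]
      smooth_on_mult[OF T(1) smooth_on_const[of _ "1/2"] smooth_on_power2[OF T(1,2)]]
    by simp_all
  have first: "fibre_deriv w ?Q (x, z) = fibre_deriv (L w) ?P (X, L z)" if "z \<noteq> 0" for w z
    by (rule fibre_deriv_linear_change[OF _ _ L(1) that])
      (use that L0 qp S(3) T(3) in \<open>auto intro: smooth_on_differentiable[OF sQ] smooth_on_differentiable[OF sP]\<close>)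
  have second: "fibre_deriv u (fibre_deriv w ?Q) (x, y)
      = fibre_deriv (L u) (fibre_deriv (L w) ?P) (X, L y)" for u w
    by (rule fibre_deriv_linear_change[OF _ _ L(1) y])
      (use y L0 first S(3) T(3) in \<open>auto intro: smooth_on_differentiable[OF smooth_on_fibre_deriv[OF sQ]]
        smooth_on_differentiable[OF smooth_on_fibre_deriv[OF sP]]\<close>)
  have surj: "surj L" using L linear_injective_imp_surjective by blast
  have "w = 0" if "\<forall>u. fibre_deriv u (fibre_deriv w ?Q) (x, y) = 0" for w
  proof -
    have "\<forall>u. fibre_deriv u (fibre_deriv (L w) ?P) (X, L y) = 0"
      using that surj unfolding second by (metis surjD)
    then have "L w = 0"
      using rank rank_metric_tensor_iff[OF T(1,2) T(3)[OF L0[OF y]]] by blast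
    then show ?thesis using L0 by blast
  qed
  then show ?thesis
    using rank_metric_tensor_iff[OF S(1,2) S(3)[OF y]] by blast
qed

section \<open>The spray of a Finsler function in a chart\<close>

definition euler_lagrange ::
  "((real ^ 'n::finite) \<times> (real ^ 'n) \<Rightarrow> real) \<Rightarrow> 'n \<Rightarrow> (real ^ 'n) \<times> (real ^ 'n) \<Rightarrow> real" where
  "euler_lagrange q l v = (\<Sum>k\<in>UNIV. snd v $ k * dx k (dy l q) v) - dx l q v"

lemma spray_coeff_eq_matrix_inv:
  "spray_coeff f i v
    = (matrix_inv (metric_tensor f v) *v (\<chi> l. euler_lagrange (\<lambda>w. (f w)\<^sup>2) l v / 4)) $ i"
  by (simp add: spray_coeff_def euler_lagrange_def matrix_vector_mult_def sum_distrib_left)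

text \<open>The geodesic equation in the implicit form \<open>4 g G = e\<close>, which avoids the inverse matrix when
two Finsler functions are compared.\<close>

lemma spray_coeff_iff:
  fixes f :: "(real ^ 'n::finite) \<times> (real ^ 'n) \<Rightarrow> real"
  assumes "rank (metric_tensor f v) = CARD('n)"
  shows "(\<forall>i. spray_coeff f i v = G $ i) \<longleftrightarrow>
    (\<forall>l. 4 * (metric_tensor f v *v G) $ l = euler_lagrange (\<lambda>w. (f w)\<^sup>2) l v)"
proof -
  have "(\<forall>i. spray_coeff f i v = G $ i) \<longleftrightarrow>
      matrix_inv (metric_tensor f v) *v (\<chi> l. euler_lagrange (\<lambda>w. (f w)\<^sup>2) l v / 4) = G"
    by (simp add: spray_coeff_eq_matrix_inv vec_eq_iff)
  also have "\<dots> \<longleftrightarrow> metric_tensor f v *v G = (\<chi> l. euler_lagrange (\<lambda>w. (f w)\<^sup>2) l v / 4)"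
    by (rule matrix_inv_mult_vec_unique[OF assms])
  finally show ?thesis by (auto simp: vec_eq_iff field_simps)
qed

locale finsler_chart =
  fixes D :: "(real ^ 'n::finite) set" and f :: "(real ^ 'n) \<times> (real ^ 'n) \<Rightarrow> real"
  assumes open_D: "open D"
    and smooth: "smooth_on (D \<times> - {0}) f"
    and pos: "\<And>x y. x \<in> D \<Longrightarrow> y \<noteq> 0 \<Longrightarrow> f (x, y) > 0"
    and homogeneous: "\<And>x y t. x \<in> D \<Longrightarrow> t > 0 \<Longrightarrow> f (x, t *\<^sub>R y) = t * f (x, y)"
    and rank: "\<And>x y. x \<in> D \<Longrightarrow> y \<noteq> 0 \<Longrightarrow> rank (metric_tensor f (x, y)) = CARD('n)"
begin

abbreviation slit :: "((real ^ 'n) \<times> (real ^ 'n)) set" where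
  "slit \<equiv> D \<times> - {0}"

lemma open_slit: "open slit"
  using open_D by (intro open_Times) auto

lemma smooth_energy: "smooth_on slit (\<lambda>v. (f v)\<^sup>2 / 2)"
  using smooth_on_mult[OF open_slit smooth_on_const[of _ "1/2"] smooth_on_power2[OF open_slit smooth]]
  by simp

lemma smooth_metric: "smooth_on slit (\<lambda>v. metric_tensor f v $ i $ j)"
  by (simp add: metric_tensor_def smooth_on_dy smooth_energy)

lemma smooth_euler_lagrange:
  assumes "smooth_on slit q"
  shows "smooth_on slit (euler_lagrange q l)"
proof -
  have "smooth_on slit (\<lambda>v. snd v $ k)" for k
    by (intro smooth_on_linear open_slit bounded_linear_compose[OF bounded_linear_vec_nth bounded_linear_snd])
  then show ?thesis
    unfolding euler_lagrange_def
    by (intro smooth_on_diff smooth_on_sum smooth_on_mult smooth_on_dx smooth_on_dy open_slit assms)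
qed

lemma smooth_spray: "smooth_on slit (spray_coeff f i)"
  unfolding spray_coeff_eq_matrix_inv
proof (rule smooth_on_matrix_inv_mult_vec[OF open_slit smooth_metric])
  show "smooth_on slit (\<lambda>v. (\<chi> l. euler_lagrange (\<lambda>w. (f w)\<^sup>2) l v / 4) $ l)" for l
    using smooth_on_mult[OF open_slit smooth_on_const[of _ "1/4"]
        smooth_euler_lagrange[OF smooth_on_power2[OF open_slit smooth]]]
    by simp
qed (use rank in auto)

lemma metric_homogeneous:
  assumes "x \<in> D" "y \<noteq> 0" "t > 0"
  shows "metric_tensor f (x, t *\<^sub>R y) = metric_tensor f (x, y)"
proof -
  have "dy j (\<lambda>w. (f w)\<^sup>2 / 2) (x, t *\<^sub>R y) = t ^ Suc 0 * dy j (\<lambda>w. (f w)\<^sup>2 / 2) (x, y)"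
    if "x \<in> D" "y \<noteq> 0" for x y j
    unfolding dy_eq_fibre_deriv
    by (rule fibre_deriv_homogeneous[OF open_D smooth_energy])
      (use that assms homogeneous in \<open>auto simp: power2_eq_square\<close>)
  then have "dy i (dy j (\<lambda>w. (f w)\<^sup>2 / 2)) (x, t *\<^sub>R y)
      = t ^ 0 * dy i (dy j (\<lambda>w. (f w)\<^sup>2 / 2)) (x, y)" for i j
    unfolding dy_eq_fibre_deriv
    by (intro fibre_deriv_homogeneous[OF open_D smooth_on_fibre_deriv[OF smooth_energy]])
      (use assms in auto)
  then show ?thesis by (simp add: metric_tensor_def)
qed

lemma spray_homogeneous:
  assumes "x \<in> D" "y \<noteq> 0" "t > 0"
  shows "spray_coeff f i (x, t *\<^sub>R y) = t\<^sup>2 * spray_coeff f i (x, y)"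
proof -
  let ?E = "\<lambda>w. (f w)\<^sup>2"
  have E: "smooth_on slit ?E" by (intro smooth_on_power2 open_slit smooth)
  have hE: "?E (x, t *\<^sub>R y) = t ^ Suc 1 * ?E (x, y)" if "x \<in> D" "y \<noteq> 0" for x y
    using that assms homogeneous by (simp add: power2_eq_square)
  have hd: "dy l ?E (x, t *\<^sub>R y) = t ^ 1 * dy l ?E (x, y)" if "x \<in> D" "y \<noteq> 0" for x y l
    unfolding dy_eq_fibre_deriv
    by (rule fibre_deriv_homogeneous[OF open_D E]) (use that assms hE in auto)
  have "dx k (dy l ?E) (x, t *\<^sub>R y) = t ^ 1 * dx k (dy l ?E) (x, y)" for k l
    by (rule dx_homogeneous[OF open_D smooth_on_dy[OF E]]) (use hd assms in auto)
  moreover have "dx l ?E (x, t *\<^sub>R y) = t ^ Suc 1 * dx l ?E (x, y)" for l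
    by (rule dx_homogeneous[OF open_D E]) (use hE assms in auto)
  ultimately have "euler_lagrange ?E l (x, t *\<^sub>R y) = t\<^sup>2 * euler_lagrange ?E l (x, y)" for l
    by (simp add: euler_lagrange_def power2_eq_square algebra_simps sum_distrib_left)
  then show ?thesis
    by (simp add: spray_coeff_eq_matrix_inv metric_homogeneous[OF assms] matrix_vector_mult_def
        sum_distrib_left algebra_simps)
qed

end

section \<open>Parallel forms in a chart\<close>

locale parallel_chart = finsler_chart D f
  for D :: "(real ^ 'n::finite) set" and f +
  fixes b :: "'n \<Rightarrow> real ^ 'n \<Rightarrow> real" and \<beta> :: "(real ^ 'n) \<times> (real ^ 'n) \<Rightarrow> real"
  assumes smooth_b: "\<And>i. smooth_on D (b i)"
    and form: "\<And>x y. x \<in> D \<Longrightarrow> \<beta> (x, y) = (\<Sum>i\<in>UNIV. b i x * y $ i)"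
    and parallel: "\<And>x y i j. x \<in> D \<Longrightarrow> y \<noteq> 0 \<Longrightarrow>
      frechet_derivative (b i) (at x) (axis j 1) = (\<Sum>h\<in>UNIV. berwald_conn f h i j (x, y) * b h x)"
begin

abbreviation db :: "real ^ 'n \<Rightarrow> 'n \<Rightarrow> 'n \<Rightarrow> real" where
  "db x i j \<equiv> frechet_derivative (b i) (at x) (axis j 1)"

text \<open>Parallelism says that at a fixed \<open>x\<close> the function \<open>\<phi>(y) = b(x) \<cdot> G(x, y)\<close> has the constant Hessian
\<open>\<partial>\<^sub>j b\<^sub>i\<close> on the punctured fibre. It is homogeneous of degree 2, so Euler's relation for its gradient
and for itself integrates this to the quadratic form. The gradient can then be computed in two ways,
and the comparison symmetrizes the matrix, that is, the form is closed.\<close>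

lemma spray_dot_form_and_closed:
  assumes x: "x \<in> D"
  shows "y \<noteq> 0 \<Longrightarrow> 2 * (\<Sum>h\<in>UNIV. b h x * spray_coeff f h (x, y))
      = (\<Sum>j\<in>UNIV. y $ j * (\<Sum>i\<in>UNIV. y $ i * db x i j))" (is "_ \<Longrightarrow> ?quadratic y")
    and "db x i j = db x j i"
proof -
  \<comment> \<open>The coefficients of the form stay frozen at \<open>x\<close>; only the spray varies.\<close>
  define \<phi> where "\<phi> = (\<lambda>v. \<Sum>h\<in>UNIV. b h x * spray_coeff f h v)"
  have s: "smooth_on slit \<phi>"
    unfolding \<phi>_def by (intro smooth_on_sum smooth_on_mult smooth_on_const smooth_spray open_slit)
  have first: "dy j \<phi> v = (\<Sum>h\<in>UNIV. b h x * dy j (spray_coeff f h) v)" if "v \<in> slit" for v j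
    unfolding \<phi>_def dy_eq_fibre_deriv
    by (rule fibre_deriv_sum) (use that smooth_on_differentiable[OF smooth_spray] in blast)
  have second: "dy i (dy j \<phi>) (x, y) = db x i j" if "y \<noteq> 0" for y i j
  proof -
    have v: "(x, y) \<in> slit" using x that by auto
    have "dy i (dy j \<phi>) (x, y) = dy i (\<lambda>v. \<Sum>h\<in>UNIV. b h x * dy j (spray_coeff f h) v) (x, y)"
      unfolding dy_eq_fibre_deriv[of i] by (rule fibre_deriv_cong[OF open_slit v first])
    also have "\<dots> = (\<Sum>h\<in>UNIV. b h x * dy i (dy j (spray_coeff f h)) (x, y))"
      unfolding dy_eq_fibre_deriv[of i]
      by (rule fibre_deriv_sum) (use v smooth_on_differentiable[OF smooth_on_dy[OF smooth_spray]] in blast)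
    finally show ?thesis
      using parallel[OF x that] by (simp add: berwald_conn_def mult.commute)
  qed
  have hom: "\<phi> (z, t *\<^sub>R y) = t ^ Suc 1 * \<phi> (z, y)" if "z \<in> D" "y \<noteq> 0" "t > 0" for z y t
    using spray_homogeneous[OF that]
    by (simp add: \<phi>_def sum_distrib_left power2_eq_square algebra_simps)
  have grad: "dy j \<phi> (x, y) = (\<Sum>i\<in>UNIV. y $ i * db x i j)" if y: "y \<noteq> 0" for y j
  proof -
    have "dy j \<phi> (x, t *\<^sub>R y) = t ^ 1 * dy j \<phi> (x, y)" if "t > 0" for t
      unfolding dy_eq_fibre_deriv
      by (rule fibre_deriv_homogeneous[OF open_D s]) (use hom x y that in auto)
    then have "fibre_deriv y (dy j \<phi>) (x, y) = dy j \<phi> (x, y)"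
      using euler_homogeneous[of "dy j \<phi>" x y 1] smooth_on_differentiable[OF smooth_on_dy[OF s]] x y
      by auto
    moreover have "fibre_deriv y (dy j \<phi>) (x, y) = (\<Sum>i\<in>UNIV. y $ i * dy i (dy j \<phi>) (x, y))"
      by (rule fibre_deriv_eq_sum) (use smooth_on_differentiable[OF smooth_on_dy[OF s]] x y in auto)
    ultimately show ?thesis using second[OF y] by simp
  qed
  have quad: "2 * \<phi> (x, y) = (\<Sum>j\<in>UNIV. y $ j * (\<Sum>i\<in>UNIV. y $ i * db x i j))" if y: "y \<noteq> 0" for y
  proof -
    have "fibre_deriv y \<phi> (x, y) = 2 * \<phi> (x, y)"
      using euler_homogeneous[of \<phi> x y "Suc 1"] smooth_on_differentiable[OF s] hom[OF x y] x y
      by auto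
    moreover have "fibre_deriv y \<phi> (x, y) = (\<Sum>j\<in>UNIV. y $ j * dy j \<phi> (x, y))"
      by (rule fibre_deriv_eq_sum) (use smooth_on_differentiable[OF s] x y in auto)
    ultimately show ?thesis using grad[OF y] by simp
  qed
  then show "y \<noteq> 0 \<Longrightarrow> ?quadratic y" by (simp add: \<phi>_def)
  \<comment> \<open>Differentiating the quadratic form gives the symmetrized matrix, to be compared with \<open>grad\<close>.\<close>
  have "dy i \<phi> (x, y) = (\<Sum>k\<in>UNIV. y $ k * db x k i) / 2 + (\<Sum>k\<in>UNIV. y $ k * db x i k) / 2"
    if y: "y \<noteq> 0" for y i
  proof -
    have *: "((\<lambda>z. (\<Sum>j\<in>UNIV. z $ j * (\<Sum>i\<in>UNIV. z $ i * db x i j)) / 2) has_derivative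
        (\<lambda>u. (\<Sum>j\<in>UNIV. y $ j * (\<Sum>i\<in>UNIV. u $ i * db x i j)
            + u $ j * (\<Sum>i\<in>UNIV. y $ i * db x i j)) / 2)) (at y)"
      by (auto intro!: derivative_eq_intros bounded_linear_imp_has_derivative[OF bounded_linear_vec_nth])
    have "((\<lambda>z. \<phi> (x, z)) has_derivative
        (\<lambda>u. (\<Sum>j\<in>UNIV. y $ j * (\<Sum>i\<in>UNIV. u $ i * db x i j)
            + u $ j * (\<Sum>i\<in>UNIV. y $ i * db x i j)) / 2)) (at y)"
      by (rule has_derivative_transform_within_open[OF *, where s = "- {0}"])
        (use y quad in \<open>auto simp flip: quad\<close>)
    from fibre_deriv_eqI[OF smooth_on_differentiable[OF s] this] x y
    show ?thesis
      by (simp add: dy_eq_fibre_deriv sum.distrib add_divide_distrib)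
  qed
  from this[of "axis i 1" j] grad[of "axis i 1" j]
  show "db x i j = db x j i"
    by simp
qed

lemma has_derivative_form:
  assumes "x \<in> D"
  shows "(\<beta> has_derivative (\<lambda>(a, u). \<Sum>i\<in>UNIV. b i x * u $ i + frechet_derivative (b i) (at x) a * y $ i))
    (at (x, y))"
proof -
  have b: "((\<lambda>v. b i (fst v)) has_derivative (\<lambda>v. frechet_derivative (b i) (at x) (fst v))) (at (x, y))" for i
    using diff_chain_at[OF has_derivative_fst[OF has_derivative_ident], of "b i" _ "(x, y)"]
      smooth_on_has_derivative[OF smooth_b assms] by (simp add: o_def)
  have y: "((\<lambda>v. snd v $ i) has_derivative (\<lambda>v. snd v $ i)) (at (x, y))" for i
    by (intro bounded_linear_imp_has_derivative bounded_linear_compose[OF bounded_linear_vec_nth bounded_linear_snd])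
  have "((\<lambda>v. \<Sum>i\<in>UNIV. b i (fst v) * snd v $ i) has_derivative
      (\<lambda>v. \<Sum>i\<in>UNIV. b i x * snd v $ i + frechet_derivative (b i) (at x) (fst v) * y $ i)) (at (x, y))"
    using has_derivative_sum[of UNIV, OF has_derivative_mult[OF b y]] by simp
  then show ?thesis
    unfolding case_prod_beta
    by (rule has_derivative_transform_within_open[where s = "D \<times> UNIV"])
      (use assms open_D form in \<open>auto intro: open_Times\<close>)
qed

lemma smooth_form: "smooth_on slit \<beta>"
proof -
  have "smooth_on slit (\<lambda>v. snd v $ i)" for i
    by (intro smooth_on_linear open_slit bounded_linear_compose[OF bounded_linear_vec_nth bounded_linear_snd])
  moreover have "smooth_on slit (\<lambda>v. b i (fst v))" for i
    by (rule smooth_on_subset[OF smooth_on_comp_fst[OF open_D smooth_b]]) auto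
  ultimately have "smooth_on slit (\<lambda>v. \<Sum>i\<in>UNIV. b i (fst v) * snd v $ i)"
    by (intro smooth_on_sum smooth_on_mult open_slit)
  then show ?thesis
    by (rule smooth_on_cong[OF open_slit]) (use form in auto)
qed

lemma fibre_deriv_form: "x \<in> D \<Longrightarrow> fibre_deriv u \<beta> (x, y) = (\<Sum>i\<in>UNIV. b i x * u $ i)"
  using linear_0[OF has_derivative_linear[OF smooth_on_has_derivative[OF smooth_b]]]
  by (simp add: fibre_deriv_def frechet_derivative_eqI[OF has_derivative_form])

lemma dy_form: "x \<in> D \<Longrightarrow> dy i \<beta> (x, y) = b i x"
  unfolding dy_eq_fibre_deriv
  by (simp add: fibre_deriv_form)

lemma dx_form: "x \<in> D \<Longrightarrow> dx j \<beta> (x, y) = (\<Sum>i\<in>UNIV. db x i j * y $ i)"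
  by (simp add: dx_def frechet_derivative_eqI[OF has_derivative_form])

lemma dy_form_squared: "x \<in> D \<Longrightarrow> dy i (\<lambda>w. (\<beta> w)\<^sup>2) (x, y) = 2 * \<beta> (x, y) * b i x"
  using dy_form[of x i y] has_derivative_form[of x y]
  by (simp add: dy_def frechet_derivative_eqI[OF has_derivative_power[of \<beta>]]
      frechet_derivative_eqI[OF has_derivative_form] ac_simps)

lemma dx_form_squared: "x \<in> D \<Longrightarrow> dx j (\<lambda>w. (\<beta> w)\<^sup>2) (x, y) = 2 * \<beta> (x, y) * dx j \<beta> (x, y)"
  using has_derivative_form[of x y]
  by (simp add: dx_def frechet_derivative_eqI[OF has_derivative_power[of \<beta>]]
      frechet_derivative_eqI[OF has_derivative_form] ac_simps)

lemma second_derivs_form_squared: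
  assumes "x \<in> D"
  shows "dy i (dy j (\<lambda>w. (\<beta> w)\<^sup>2)) (x, y) = 2 * b i x * b j x"
    and "dx k (dy j (\<lambda>w. (\<beta> w)\<^sup>2)) (x, y) = 2 * dx k \<beta> (x, y) * b j x + 2 * \<beta> (x, y) * db x j k"
proof -
  have o: "open (D \<times> (UNIV :: (real ^ 'n) set))" using open_D by (intro open_Times) auto
  have *: "frechet_derivative (dy j (\<lambda>w. (\<beta> w)\<^sup>2)) (at (x, y))
      = frechet_derivative (\<lambda>w. 2 * \<beta> w * b j (fst w)) (at (x, y))"
    by (rule frechet_derivative_cong_open[OF o]) (use assms dy_form_squared in auto)
  have b: "((\<lambda>v. b j (fst v)) has_derivative (\<lambda>v. frechet_derivative (b j) (at x) (fst v))) (at (x, y))"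
    using diff_chain_at[OF has_derivative_fst[OF has_derivative_ident], of "b j" _ "(x, y)"]
      smooth_on_has_derivative[OF smooth_b assms] by (simp add: o_def)
  have B: "(\<beta> has_derivative frechet_derivative \<beta> (at (x, y))) (at (x, y))"
    using differentiableI[OF has_derivative_form[OF assms]] unfolding frechet_derivative_works .
  have **: "frechet_derivative (\<lambda>w. 2 * \<beta> w * b j (fst w)) (at (x, y)) c
     = 2 * \<beta> (x, y) * frechet_derivative (b j) (at x) (fst c) + 2 * frechet_derivative \<beta> (at (x, y)) c * b j x" for c
    using has_derivative_mult[OF has_derivative_mult_right[OF B, of 2] b]
    by (subst frechet_derivative_eqI) auto
  have "linear (frechet_derivative (b j) (at x))"
    using smooth_on_has_derivative[OF smooth_b assms] by (rule has_derivative_linear)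
  then show "dy i (dy j (\<lambda>w. (\<beta> w)\<^sup>2)) (x, y) = 2 * b i x * b j x"
    using dy_form[OF assms, of i y] by (simp add: dy_def[of i] * ** linear_0)
  show "dx k (dy j (\<lambda>w. (\<beta> w)\<^sup>2)) (x, y) = 2 * dx k \<beta> (x, y) * b j x + 2 * \<beta> (x, y) * db x j k"
    by (simp add: dx_def * **)
qed

text \<open>Closedness cancels the terms with the factor \<open>\<beta>\<close>. What remains is the derivative of \<open>\<beta>\<close> along
the base part of the spray, which balances its fibre part since \<open>\<beta>\<close> is constant along geodesics.\<close>

lemma euler_lagrange_form_squared:
  assumes "x \<in> D" "y \<noteq> 0"
  shows "euler_lagrange (\<lambda>w. (\<beta> w)\<^sup>2) l (x, y) = 4 * b l x * (\<Sum>h\<in>UNIV. b h x * spray_coeff f h (x, y))"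
proof -
  have "euler_lagrange (\<lambda>w. (\<beta> w)\<^sup>2) l (x, y)
      = 2 * b l x * (\<Sum>k\<in>UNIV. y $ k * dx k \<beta> (x, y))
        + 2 * \<beta> (x, y) * ((\<Sum>k\<in>UNIV. y $ k * db x l k) - dx l \<beta> (x, y))"
    using assms(1)
    by (simp add: euler_lagrange_def second_derivs_form_squared dx_form_squared
        sum.distrib sum_distrib_left algebra_simps)
  also have "dx l \<beta> (x, y) = (\<Sum>k\<in>UNIV. y $ k * db x l k)"
    using assms(1) spray_dot_form_and_closed(2)[OF assms(1), of l] by (simp add: dx_form mult.commute)
  also have "(\<Sum>k\<in>UNIV. y $ k * dx k \<beta> (x, y)) = 2 * (\<Sum>h\<in>UNIV. b h x * spray_coeff f h (x, y))"
    unfolding spray_dot_form_and_closed(1)[OF assms] using assms(1)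
    by (simp add: dx_form mult.commute)
  finally show ?thesis by simp
qed

end

section \<open>Deformation by a parallel form\<close>

text \<open>The domain is left general because the deformation is used both for functions on the tangent
bundle and for their coordinate expressions.\<close>

definition deform ::
  "real \<Rightarrow> ('v \<Rightarrow> real) \<Rightarrow> ('v \<Rightarrow> real) \<Rightarrow> 'v \<Rightarrow> real" where
  "deform \<epsilon> F \<beta> = (\<lambda>v. sqrt ((F v)\<^sup>2 + \<epsilon> * (\<beta> v)\<^sup>2))"

lemma deform_power2: "\<epsilon> \<ge> 0 \<Longrightarrow> (deform \<epsilon> F \<beta> v)\<^sup>2 = (F v)\<^sup>2 + \<epsilon> * (\<beta> v)\<^sup>2"
  by (simp add: deform_def)

lemma frechet_derivative_lincomb:
  fixes p q :: "'a::real_normed_vector \<Rightarrow> real"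
  assumes "p differentiable (at v)" "q differentiable (at v)"
  shows "frechet_derivative (\<lambda>w. c * p w + d * q w) (at v) a
    = c * frechet_derivative p (at v) a + d * frechet_derivative q (at v) a"
  using assms unfolding frechet_derivative_works
  by (intro frechet_derivative_eqI has_derivative_add has_derivative_mult_right)

context parallel_chart
begin

definition form_vec :: "real ^ 'n \<Rightarrow> real ^ 'n" where
  "form_vec x = (\<chi> i. b i x)"

text \<open>The squared norm of the form with respect to the inverse metric.\<close>

definition form_norm2 :: "(real ^ 'n) \<times> (real ^ 'n) \<Rightarrow> real" where
  "form_norm2 v = form_vec (fst v) \<bullet> (matrix_inv (metric_tensor f v) *v form_vec (fst v))"

lemma form_inner: "x \<in> D \<Longrightarrow> \<beta> (x, y) = form_vec x \<bullet> y"
  by (simp add: form form_vec_def inner_vec_def)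

lemma smooth_deform: "\<epsilon> \<ge> 0 \<Longrightarrow> smooth_on slit (deform \<epsilon> f \<beta>)"
  unfolding deform_def
  by (intro smooth_on_sqrt smooth_on_add smooth_on_mult smooth_on_const smooth_on_power2 open_slit
      smooth smooth_form) (use pos in \<open>fastforce intro: add_pos_nonneg\<close>)

lemma deform_pos: "\<epsilon> \<ge> 0 \<Longrightarrow> v \<in> slit \<Longrightarrow> deform \<epsilon> f \<beta> v > 0"
  unfolding deform_def using pos by (fastforce intro: add_pos_nonneg)

lemma deform_homogeneous:
  assumes "x \<in> D" "t > 0"
  shows "deform \<epsilon> f \<beta> (x, t *\<^sub>R y) = t * deform \<epsilon> f \<beta> (x, y)"
proof -
  have "(f (x, t *\<^sub>R y))\<^sup>2 + \<epsilon> * (\<beta> (x, t *\<^sub>R y))\<^sup>2 = t\<^sup>2 * ((f (x, y))\<^sup>2 + \<epsilon> * (\<beta> (x, y))\<^sup>2)"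
    using assms by (simp add: homogeneous form_inner power_mult_distrib algebra_simps)
  then show ?thesis using assms by (simp add: deform_def real_sqrt_mult)
qed

lemma metric_deform:
  assumes "\<epsilon> \<ge> 0" "x \<in> D" "y \<noteq> 0"
  shows "metric_tensor (deform \<epsilon> f \<beta>) (x, y) *v w
    = metric_tensor f (x, y) *v w + (\<epsilon> * (form_vec x \<bullet> w)) *\<^sub>R form_vec x"
proof -
  let ?E = "\<lambda>w. (f w)\<^sup>2 / 2" and ?B = "\<lambda>w. (\<beta> w)\<^sup>2"
  have v: "(x, y) \<in> slit" using assms by auto
  have sB: "smooth_on slit ?B" by (intro smooth_on_power2 open_slit smooth_form)
  have eq: "(\<lambda>w. (deform \<epsilon> f \<beta> w)\<^sup>2 / 2) = (\<lambda>w. 1 * ?E w + (\<epsilon> / 2) * ?B w)"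
    using assms by (simp add: deform_power2 fun_eq_iff field_simps)
  have "dy j (\<lambda>w. (deform \<epsilon> f \<beta> w)\<^sup>2 / 2) v = 1 * dy j ?E v + (\<epsilon> / 2) * dy j ?B v" if "v \<in> slit" for j v
    unfolding eq unfolding dy_def
    by (rule frechet_derivative_lincomb)
      (use that smooth_on_differentiable[OF smooth_energy] smooth_on_differentiable[OF sB] in auto)
  then have "dy i (dy j (\<lambda>w. (deform \<epsilon> f \<beta> w)\<^sup>2 / 2)) (x, y)
      = dy i (\<lambda>v. 1 * dy j ?E v + (\<epsilon> / 2) * dy j ?B v) (x, y)" for i j
    unfolding dy_eq_fibre_deriv[of i] by (intro fibre_deriv_cong[OF open_slit v]) auto
  also have "\<dots> i j = 1 * dy i (dy j ?E) (x, y) + (\<epsilon> / 2) * dy i (dy j ?B) (x, y)" for i j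
    unfolding dy_def[of i]
    by (rule frechet_derivative_lincomb)
      (use v smooth_on_differentiable[OF smooth_on_dy[OF smooth_energy]]
        smooth_on_differentiable[OF smooth_on_dy[OF sB]] in auto)
  finally have "metric_tensor (deform \<epsilon> f \<beta>) (x, y) $ i $ j
      = metric_tensor f (x, y) $ i $ j + \<epsilon> * (b i x * b j x)" for i j
    by (simp add: metric_tensor_def second_derivs_form_squared[OF assms(2)])
  then show ?thesis
    by (simp add: vec_eq_iff matrix_vector_mult_def form_vec_def inner_vec_def
        sum.distrib sum_distrib_left sum_distrib_right algebra_simps)
qed

lemma euler_lagrange_deform:
  assumes "\<epsilon> \<ge> 0" "x \<in> D" "y \<noteq> 0"
  shows "euler_lagrange (\<lambda>w. (deform \<epsilon> f \<beta> w)\<^sup>2) l (x, y)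
    = euler_lagrange (\<lambda>w. (f w)\<^sup>2) l (x, y) + \<epsilon> * euler_lagrange (\<lambda>w. (\<beta> w)\<^sup>2) l (x, y)"
proof -
  let ?E = "\<lambda>w. (f w)\<^sup>2" and ?B = "\<lambda>w. (\<beta> w)\<^sup>2" and ?H = "\<lambda>w. (deform \<epsilon> f \<beta> w)\<^sup>2"
  have v: "(x, y) \<in> slit" using assms by auto
  have sE: "smooth_on slit ?E" by (intro smooth_on_power2 open_slit smooth)
  have sB: "smooth_on slit ?B" by (intro smooth_on_power2 open_slit smooth_form)
  have eq: "?H = (\<lambda>w. 1 * ?E w + \<epsilon> * ?B w)"
    using assms by (simp add: deform_power2 fun_eq_iff)
  have "dy j ?H v = 1 * dy j ?E v + \<epsilon> * dy j ?B v" if "v \<in> slit" for j v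
    unfolding eq unfolding dy_def
    by (rule frechet_derivative_lincomb)
      (use that smooth_on_differentiable[OF sE] smooth_on_differentiable[OF sB] in auto)
  then have "dx i (dy j ?H) (x, y) = dx i (\<lambda>v. 1 * dy j ?E v + \<epsilon> * dy j ?B v) (x, y)" for i j
    by (intro dx_cong[OF open_slit v]) auto
  also have "\<dots> i j = 1 * dx i (dy j ?E) (x, y) + \<epsilon> * dx i (dy j ?B) (x, y)" for i j
    unfolding dx_def
    by (rule frechet_derivative_lincomb)
      (use v smooth_on_differentiable[OF smooth_on_dy[OF sE]]
        smooth_on_differentiable[OF smooth_on_dy[OF sB]] in auto)
  finally have "dx i (dy j ?H) (x, y) = dx i (dy j ?E) (x, y) + \<epsilon> * dx i (dy j ?B) (x, y)" for i j
    by simp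
  moreover have "dx j ?H (x, y) = 1 * dx j ?E (x, y) + \<epsilon> * dx j ?B (x, y)" for j
    unfolding eq unfolding dx_def
    by (rule frechet_derivative_lincomb)
      (use v smooth_on_differentiable[OF sE] smooth_on_differentiable[OF sB] in auto)
  ultimately show ?thesis
    by (simp add: euler_lagrange_def sum.distrib sum_distrib_left algebra_simps)
qed

text \<open>The coefficients \<open>G\<close> of the spray of \<open>F\<close> also solve the implicit geodesic equation of the
deformation: its matrix gains \<open>\<epsilon> b b\<^sup>T\<close>, its right-hand side gains \<open>\<epsilon>\<close> times the Euler-Lagrange
expression of \<open>\<beta>\<^sup>2\<close>, and on \<open>G\<close> these agree.\<close>

lemma spray_deform:
  assumes "\<epsilon> \<ge> 0" "x \<in> D" "y \<noteq> 0"
    and "rank (metric_tensor (deform \<epsilon> f \<beta>) (x, y)) = CARD('n)"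
  shows "spray_coeff (deform \<epsilon> f \<beta>) i (x, y) = spray_coeff f i (x, y)"
proof -
  define G where "G = (\<chi> i. spray_coeff f i (x, y))"
  have "4 * (metric_tensor f (x, y) *v G) $ l = euler_lagrange (\<lambda>w. (f w)\<^sup>2) l (x, y)" for l
    using spray_coeff_iff[OF rank[OF assms(2,3)], of G] by (simp add: G_def)
  moreover have "form_vec x \<bullet> G = (\<Sum>h\<in>UNIV. b h x * spray_coeff f h (x, y))"
    by (simp add: G_def form_vec_def inner_vec_def)
  ultimately have "4 * (metric_tensor (deform \<epsilon> f \<beta>) (x, y) *v G) $ l
      = euler_lagrange (\<lambda>w. (deform \<epsilon> f \<beta> w)\<^sup>2) l (x, y)" for l
    using metric_deform[OF assms(1-3), of G] euler_lagrange_deform[OF assms(1-3), of l]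
      euler_lagrange_form_squared[OF assms(2,3), of l]
    by (simp add: form_vec_def)
  then show ?thesis
    using spray_coeff_iff[OF assms(4), of G] by (simp add: G_def)
qed

text \<open>A rank-one perturbation: a vector \<open>w\<close> of the kernel is a multiple of the vector \<open>B\<close> dual to \<open>b\<close>, and pairing with \<open>b\<close>
gives \<open>(b \<cdot> w) (1 + \<epsilon> \<bar>b\<bar>\<^sup>2) = 0\<close>.\<close>

lemma rank_deform:
  assumes "\<epsilon> \<ge> 0" "x \<in> D" "y \<noteq> 0" and "1 + \<epsilon> * form_norm2 (x, y) > 0"
  shows "rank (metric_tensor (deform \<epsilon> f \<beta>) (x, y)) = CARD('n)"
proof -
  let ?g = "metric_tensor f (x, y)"
  define B where "B = matrix_inv ?g *v form_vec x"
  have gB: "?g *v B = form_vec x"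
    using matrix_inv_mult_vec_unique[OF rank[OF assms(2,3)]] B_def by blast
  have "w = 0" if w: "metric_tensor (deform \<epsilon> f \<beta>) (x, y) *v w = 0" for w
  proof -
    let ?c = "\<epsilon> * (form_vec x \<bullet> w)"
    have "?g *v (w + ?c *\<^sub>R B) = 0"
      using w unfolding metric_deform[OF assms(1-3)]
      by (simp add: matrix_vector_right_distrib matrix_vector_mult_scaleR gB)
    then have *: "w + ?c *\<^sub>R B = 0"
      using rank[OF assms(2,3)] unfolding full_rank_injective
      by (metis injD matrix_vector_mult_0_right)
    then have "form_vec x \<bullet> (w + ?c *\<^sub>R B) = 0" by simp
    then have "(form_vec x \<bullet> w) * (1 + \<epsilon> * form_norm2 (x, y)) = 0"
      by (simp add: form_norm2_def B_def inner_add_right algebra_simps)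
    then have "form_vec x \<bullet> w = 0" using assms(4) by simp
    then show "w = 0" using * by simp
  qed
  then show ?thesis
    unfolding full_rank_injective by (simp add: linear_injective_0 matrix_vector_mul_linear)
qed

lemma form_norm2_homogeneous:
  "x \<in> D \<Longrightarrow> y \<noteq> 0 \<Longrightarrow> t > 0 \<Longrightarrow> form_norm2 (x, t *\<^sub>R y) = form_norm2 (x, y)"
  by (simp add: form_norm2_def metric_homogeneous)

lemma continuous_form_norm2: "continuous_on slit form_norm2"
proof -
  have b: "smooth_on slit (\<lambda>v. form_vec (fst v) $ i)" for i
    unfolding form_vec_def vec_lambda_beta
    by (rule smooth_on_subset[OF smooth_on_comp_fst[OF open_D smooth_b]]) auto
  have "smooth_on slit form_norm2"
    unfolding form_norm2_def inner_vec_def inner_real_def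
    by (intro smooth_on_sum smooth_on_mult smooth_on_matrix_inv_mult_vec open_slit smooth_metric b)
      (use rank in auto)
  then show ?thesis by (rule smooth_on_continuous)
qed

text \<open>By homogeneity of degree 0 the norm of the form takes all its values over \<open>K\<close> on the compact set of
unit vectors, so it is bounded there.\<close>

lemma exists_deformation_parameter:
  assumes "compact K" "K \<subseteq> D"
  obtains \<epsilon> where "\<epsilon> > 0" "\<And>x y. x \<in> K \<Longrightarrow> y \<noteq> 0 \<Longrightarrow> 1 + \<epsilon> * form_norm2 (x, y) > 0"
proof -
  have "compact (form_norm2 ` (K \<times> sphere 0 1))"
    using assms
    by (intro compact_continuous_image compact_Times continuous_on_subset[OF continuous_form_norm2]) auto
  then obtain M where M: "\<And>v. v \<in> K \<times> sphere 0 1 \<Longrightarrow> \<bar>form_norm2 v\<bar> \<le> M" "M > 0"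
    unfolding bounded_pos by (metis bounded_pos compact_imp_bounded imageI real_norm_def)
  show ?thesis
  proof
    show "1 / (M + 1) > 0" using M(2) by simp
    fix x and y :: "real ^ 'n" assume xy: "x \<in> K" "y \<noteq> 0"
    have "form_norm2 (x, y) = form_norm2 (x, (1 / norm y) *\<^sub>R y)"
      by (rule form_norm2_homogeneous[symmetric]) (use xy assms in auto)
    also have "\<bar>\<dots>\<bar> \<le> M" using xy by (intro M(1)) auto
    finally have "- (M + 1) < form_norm2 (x, y)" by linarith
    then show "1 + 1 / (M + 1) * form_norm2 (x, y) > 0"
      using M(2) by (simp add: field_simps)
  qed
qed

text \<open>Stated for the product with the deformation, as the derivative of its square, to avoid the
derivative of the square root.\<close>

lemma fibre_deriv_deform:
  assumes "\<epsilon> \<ge> 0" "x \<in> D" "y \<noteq> 0"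
  shows "deform \<epsilon> f \<beta> (x, y) * fibre_deriv u (deform \<epsilon> f \<beta>) (x, y)
    = f (x, y) * fibre_deriv u f (x, y) + \<epsilon> * \<beta> (x, y) * (form_vec x \<bullet> u)"
proof -
  have v: "(x, y) \<in> slit" using assms by auto
  have power2: "fibre_deriv u (\<lambda>w. (q w)\<^sup>2) (x, y) = 2 * q (x, y) * fibre_deriv u q (x, y)"
    if "smooth_on slit q" for q
    using has_derivative_power[OF smooth_on_has_derivative[OF that v], of 2]
    by (simp add: fibre_deriv_def frechet_derivative_eqI ac_simps)
  have eq: "(\<lambda>w. (deform \<epsilon> f \<beta> w)\<^sup>2) = (\<lambda>w. 1 * (f w)\<^sup>2 + \<epsilon> * (\<beta> w)\<^sup>2)"
    using assms by (simp add: deform_power2 fun_eq_iff)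
  have "fibre_deriv u (\<lambda>w. (deform \<epsilon> f \<beta> w)\<^sup>2) (x, y)
      = 1 * fibre_deriv u (\<lambda>w. (f w)\<^sup>2) (x, y) + \<epsilon> * fibre_deriv u (\<lambda>w. (\<beta> w)\<^sup>2) (x, y)"
    unfolding eq unfolding fibre_deriv_def
    by (intro frechet_derivative_lincomb smooth_on_differentiable[OF _ v] smooth_on_power2 open_slit
        smooth smooth_form)
  then show ?thesis
    using fibre_deriv_form[OF assms(2), of u y]
    by (simp add: power2 smooth_deform[OF assms(1)] smooth smooth_form form_vec_def inner_vec_def)
qed

text \<open>If the wedge product vanishes near a vector where \<open>\<beta> \<noteq> 0\<close>, evaluate it on \<open>w\<close> in the kernel of the
form and on the radial vector \<open>y\<close>: by Euler's relation this leaves \<open>\<epsilon> \<beta>\<^sup>2\<close> times the derivative of \<open>F\<close>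
along \<open>w\<close>. So \<open>F\<^sup>2\<close> is constant in direction \<open>w\<close> on an open part of the fibre, and \<open>g\<close> is degenerate.\<close>

lemma functionally_independent_deform:
  assumes n: "CARD('n) \<ge> 2" and \<epsilon>: "\<epsilon> > 0" and nz: "\<And>x. x \<in> D \<Longrightarrow> form_vec x \<noteq> 0"
  shows "slit \<subseteq> closure {v \<in> slit. \<exists>a c. wedge_diff f (deform \<epsilon> f \<beta>) v a c \<noteq> 0}" (is "_ \<subseteq> closure ?T")
proof (rule subsetI, rule ccontr)
  fix v assume v: "v \<in> slit" "v \<notin> closure ?T"
  obtain x y0 where xy0: "v = (x, y0)" "x \<in> D" "y0 \<noteq> 0" using v by auto
  define N where "N = {y. (x, y) \<in> slit - closure ?T}"
  have N: "open N" "y0 \<in> N"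
  proof -
    have "open ((\<lambda>y. (x, y)) -` (slit - closure ?T))"
      by (intro open_vimage open_Diff open_slit closed_closure continuous_intros)
    then show "open N" by (simp add: N_def vimage_def)
    show "y0 \<in> N" using v xy0 by (simp add: N_def)
  qed
  \<comment> \<open>A vector in the kernel of the form is pushed off it in the direction of its coefficients.\<close>
  obtain y1 where y1: "y1 \<in> N" "form_vec x \<bullet> y1 \<noteq> 0"
  proof (cases "form_vec x \<bullet> y0 = 0")
    case True
    have "open ((\<lambda>t. y0 + t *\<^sub>R form_vec x) -` N)"
      by (intro open_vimage N continuous_intros)
    then have "(\<lambda>t. y0 + t *\<^sub>R form_vec x) -` N \<noteq> {0}"
      using not_open_singleton by metis
    moreover have "0 \<in> (\<lambda>t. y0 + t *\<^sub>R form_vec x) -` N" using N by simp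
    ultimately obtain t where "t \<noteq> 0" "y0 + t *\<^sub>R form_vec x \<in> N" by blast
    then show ?thesis
      using True nz[OF xy0(2)] by (intro that[of "y0 + t *\<^sub>R form_vec x"]) (auto simp: inner_add_right)
  qed (use N that in blast)
  define W where "W = N \<inter> {y. form_vec x \<bullet> y \<noteq> 0}"
  have W: "open W" "y1 \<in> W"
    using y1 N by (auto simp: W_def intro!: open_Int open_Collect_neq continuous_intros)
  obtain w where w: "w \<noteq> 0" "form_vec x \<bullet> w = 0"
    using orthogonal_to_vector_exists[of "form_vec x"] n by (auto simp: orthogonal_def)
  have fw: "fibre_deriv w f (x, y) = 0" if "y \<in> W" for y
  proof -
    have "(x, y) \<in> slit - closure ?T" "form_vec x \<bullet> y \<noteq> 0"
      using that by (simp_all add: W_def N_def)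
    then have y: "(x, y) \<in> slit" "(x, y) \<notin> ?T" "y \<noteq> 0" "\<beta> (x, y) \<noteq> 0"
      using closure_subset[of ?T] xy0(2) by (blast, blast, simp, simp add: form_inner)
    let ?d = "deform \<epsilon> f \<beta>"
    have euler: "fibre_deriv y f (x, y) = f (x, y)"
      using euler_homogeneous[of f x y 1] smooth_on_differentiable[OF smooth y(1)]
        homogeneous[OF xy0(2)] by simp
    have "wedge_diff f ?d (x, y) (0, w) (0, y) = 0" using y(1,2) by blast
    then have "fibre_deriv w f (x, y) * fibre_deriv y ?d (x, y) = f (x, y) * fibre_deriv w ?d (x, y)"
      using euler by (simp add: wedge_diff_def fibre_deriv_def)
    then have "fibre_deriv w f (x, y) * (?d (x, y) * fibre_deriv y ?d (x, y))
        = f (x, y) * (?d (x, y) * fibre_deriv w ?d (x, y))"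
      by (metis mult.left_commute)
    then have "fibre_deriv w f (x, y) * (\<epsilon> * (\<beta> (x, y))\<^sup>2) = 0"
      using fibre_deriv_deform[of \<epsilon> x y] \<epsilon> xy0(2) y(3) euler w(2)
      by (simp add: form_inner power2_eq_square algebra_simps)
    then show ?thesis using \<epsilon> y(4) by simp
  qed
  have "fibre_deriv u (fibre_deriv w (\<lambda>z. (f z)\<^sup>2 / 2)) (x, y1) = 0" for u
  proof (rule fibre_deriv_eqI[where D = "\<lambda>u. 0"])
    have y1': "(x, y) \<in> slit" if "y \<in> W" for y using that by (auto simp: W_def N_def)
    show "fibre_deriv w (\<lambda>z. (f z)\<^sup>2 / 2) differentiable at (x, y1)"
      by (intro smooth_on_differentiable[OF smooth_on_fibre_deriv[OF smooth_energy]] y1' W)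
    have "fibre_deriv w (\<lambda>z. (f z)\<^sup>2 / 2) (x, y) = 0" if "y \<in> W" for y
    proof -
      have "((\<lambda>z. (f z)\<^sup>2 / 2) has_derivative
          (\<lambda>a. f (x, y) * frechet_derivative f (at (x, y)) a)) (at (x, y))"
        using smooth_on_has_derivative[OF smooth y1'[OF that]]
        by (auto intro!: derivative_eq_intros)
      then show ?thesis using fw[OF that] by (simp add: fibre_deriv_def frechet_derivative_eqI)
    qed
    then show "((\<lambda>y. fibre_deriv w (\<lambda>z. (f z)\<^sup>2 / 2) (x, y)) has_derivative (\<lambda>u. 0)) (at y1)"
      by (intro has_derivative_transform_within_open[OF has_derivative_const[of 0] W]) auto
  qed
  moreover have "y1 \<noteq> 0" using y1 by auto
  ultimately show False
    using rank_metric_tensor_iff[OF open_slit smooth, of "(x, y1)"] rank[OF xy0(2), of y1] xy0(2) w(1)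
    by auto
qed

text \<open>Uniqueness for the linear equation \<open>\<partial>\<^sub>j b\<^sub>i = G\<^sup>h\<^sub>i\<^sub>j b\<^sub>h\<close>, evaluated at a fixed direction \<open>e\<close>. On a small ball the
derivative of \<open>b\<close> is at most a constant times the maximum of \<open>\<bar>b\<bar>\<close>; if the radius is small against
this constant, the mean value inequality bounds the maximum by half of itself.\<close>

lemma form_vanishes_near_zero:
  assumes x0: "x0 \<in> D" "form_vec x0 = 0"
  obtains r where "r > 0" "ball x0 r \<subseteq> D" "\<And>x. x \<in> ball x0 r \<Longrightarrow> form_vec x = 0"
proof -
  obtain R where R: "R > 0" "cball x0 R \<subseteq> D"
    using open_contains_cball open_D x0 by blast
  obtain e :: "real ^ 'n" where e: "e \<noteq> 0" using axis_eq_0_iff[of _ "1::real"] by fastforce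
  define \<Gamma> where "\<Gamma> x = (\<Sum>i\<in>UNIV. \<Sum>j\<in>UNIV. \<Sum>h\<in>UNIV. \<bar>berwald_conn f h i j (x, e)\<bar>)" for x
  define m where "m x = (\<Sum>h\<in>UNIV. \<bar>b h x\<bar>)" for x
  have "continuous_on (cball x0 R) \<Gamma>"
  proof -
    have "continuous_on slit (berwald_conn f h i j)" for h i j
      unfolding berwald_conn_def by (intro smooth_on_continuous smooth_on_dy smooth_spray)
    then have "continuous_on (cball x0 R) (\<lambda>x. berwald_conn f h i j (x, e))" for h i j
      by (rule continuous_on_compose2) (use R e in \<open>auto intro!: continuous_intros\<close>)
    then show ?thesis unfolding \<Gamma>_def by (intro continuous_intros)
  qed
  then have "bounded (\<Gamma> ` cball x0 R)"
    by (intro compact_imp_bounded compact_continuous_image) auto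
  then obtain M where M: "M > 0" "\<And>x. x \<in> cball x0 R \<Longrightarrow> \<bar>\<Gamma> x\<bar> \<le> M"
    unfolding bounded_pos by (auto simp del: mem_cball)
  have db: "\<bar>frechet_derivative (b i) (at x) u\<bar> \<le> (real CARD('n) * (M * m x)) * norm u" if x: "x \<in> cball x0 R" for i x u
  proof -
    have xD: "x \<in> D" using x R(2) by blast
    have "linear (frechet_derivative (b i) (at x))"
      using smooth_on_has_derivative[OF smooth_b xD] by (rule has_derivative_linear)
    then interpret linear "frechet_derivative (b i) (at x)" .
    have le: "\<bar>berwald_conn f h i j (x, e)\<bar> \<le> M" for h j
    proof -
      have "\<bar>berwald_conn f h i j (x, e)\<bar> \<le> (\<Sum>h\<in>UNIV. \<bar>berwald_conn f h i j (x, e)\<bar>)"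
        by (rule member_le_sum) auto
      also have "\<dots> \<le> (\<Sum>j\<in>UNIV. \<Sum>h\<in>UNIV. \<bar>berwald_conn f h i j (x, e)\<bar>)"
        by (rule member_le_sum) (auto intro: sum_nonneg)
      also have "\<dots> \<le> \<Gamma> x"
        unfolding \<Gamma>_def by (rule member_le_sum) (auto intro: sum_nonneg)
      finally show ?thesis using M(2)[OF x] by linarith
    qed
    have axis: "\<bar>db x i j\<bar> \<le> M * m x" for j
    proof -
      have "\<bar>db x i j\<bar> \<le> (\<Sum>h\<in>UNIV. \<bar>berwald_conn f h i j (x, e)\<bar> * \<bar>b h x\<bar>)"
        unfolding parallel[OF xD e] abs_mult[symmetric] by (rule sum_abs)
      also have "\<dots> \<le> (\<Sum>h\<in>UNIV. M * \<bar>b h x\<bar>)"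
        by (intro sum_mono mult_right_mono le) auto
      finally show ?thesis by (simp add: m_def sum_distrib_left)
    qed
    have "u = (\<Sum>j\<in>UNIV. u $ j *\<^sub>R axis j 1)"
      using basis_expansion[of u] by (simp add: scalar_mult_eq_scaleR)
    then have "frechet_derivative (b i) (at x) u
        = frechet_derivative (b i) (at x) (\<Sum>j\<in>UNIV. u $ j *\<^sub>R axis j 1)"
      by (rule arg_cong)
    then have "frechet_derivative (b i) (at x) u = (\<Sum>j\<in>UNIV. u $ j * db x i j)"
      unfolding sum scale real_scaleR_def .
    then have "\<bar>frechet_derivative (b i) (at x) u\<bar> \<le> (\<Sum>j\<in>UNIV. \<bar>u $ j\<bar> * \<bar>db x i j\<bar>)"
      using sum_abs[of "\<lambda>j. u $ j * db x i j" UNIV] by (simp add: abs_mult)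
    also have "\<dots> \<le> (\<Sum>j\<in>(UNIV :: 'n set). norm u * (M * m x))"
      by (intro sum_mono mult_mono axis component_le_norm_cart) auto
    finally show ?thesis by (simp add: algebra_simps)
  qed
  let ?n = "real CARD('n)"
  have npos: "?n > 0" by simp
  \<comment> \<open>One factor \<open>?n\<close> comes from the directions of the derivative, one from the sum in \<open>m\<close>.\<close>
  define r where "r = min R (1 / (2 * ?n * ?n * M))"
  have r: "r > 0" "r \<le> R" "?n * ?n * M * r \<le> 1 / 2"
  proof -
    show "r > 0" "r \<le> R" using R M npos by (simp_all add: r_def)
    have "?n * ?n * M * r \<le> ?n * ?n * M * (1 / (2 * ?n * ?n * M))"
      using M npos by (intro mult_left_mono) (auto simp: r_def)
    also have "\<dots> = 1 / 2" using M npos by simp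
    finally show "?n * ?n * M * r \<le> 1 / 2" .
  qed
  have cm: "continuous_on (cball x0 r) m"
    unfolding m_def using R r
    by (intro continuous_intros continuous_on_subset[OF smooth_on_continuous[OF smooth_b]])
      (auto simp: subset_iff)
  obtain x1 where x1: "x1 \<in> cball x0 r" "\<And>x. x \<in> cball x0 r \<Longrightarrow> m x \<le> m x1"
    using continuous_attains_sup[OF compact_cball _ cm] r by fastforce
  have m0: "m x \<ge> 0" for x by (auto simp: m_def intro: sum_nonneg)
  have "\<bar>b i x1\<bar> \<le> (?n * (M * m x1)) * r" for i
  proof -
    have "norm (b i x1 - b i x0) \<le> (?n * (M * m x1)) * norm (x1 - x0)"
    proof (rule differentiable_bound[where S = "cball x0 r" and f' = "\<lambda>x. frechet_derivative (b i) (at x)"])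
      fix x assume x: "x \<in> cball x0 r"
      then have xR: "x \<in> cball x0 R" using r by auto
      then show "(b i has_derivative frechet_derivative (b i) (at x)) (at x within cball x0 r)"
        using R(2) xR by (blast intro: has_derivative_at_withinI smooth_on_has_derivative[OF smooth_b])
      show "onorm (frechet_derivative (b i) (at x)) \<le> ?n * (M * m x1)"
      proof (rule onorm_le)
        fix u
        have "norm (frechet_derivative (b i) (at x) u) \<le> (?n * (M * m x)) * norm u"
          using db[OF xR] by simp
        also have "\<dots> \<le> (?n * (M * m x1)) * norm u"
          using x1(2)[OF x] M by (intro mult_right_mono mult_left_mono) auto
        finally show "norm (frechet_derivative (b i) (at x) u) \<le> (?n * (M * m x1)) * norm u" .
      qed
    qed (use x1 r in auto)
    also have "\<dots> \<le> (?n * (M * m x1)) * r"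
      using x1(1) M m0[of x1] by (intro mult_left_mono) (auto simp: dist_norm norm_minus_commute)
    finally show ?thesis using x0(2) by (simp add: form_vec_def vec_eq_iff)
  qed
  then have "m x1 \<le> (\<Sum>i\<in>(UNIV :: 'n set). (?n * (M * m x1)) * r)"
    unfolding m_def by (rule sum_mono)
  also have "\<dots> = (?n * ?n * M * r) * m x1" by simp
  also have "\<dots> \<le> 1 / 2 * m x1" using r(3) m0 by (rule mult_right_mono)
  finally have "m x1 \<le> 0" by simp
  show ?thesis
  proof
    show "r > 0" by (rule r)
    show "ball x0 r \<subseteq> D" using R r by auto
    fix x assume "x \<in> ball x0 r"
    then have "m x \<le> 0" using x1(2)[of x] \<open>m x1 \<le> 0\<close> by (auto simp: less_imp_le)
    then have "m x = 0" using m0 by (metis antisym)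
    then show "form_vec x = 0"
      by (simp add: m_def sum_nonneg_eq_0_iff form_vec_def vec_eq_iff)
  qed
qed

end

section \<open>Globalization\<close>

lemma openin_chart_preimage:
  assumes M: "smooth_manifold X A" "c \<in> A" and W: "open W"
  shows "openin X {p \<in> cdom c. cmap c p \<in> W}"
proof -
  have h: "homeomorphic_map (subtopology X (cdom c)) (top_of_set (cmap c ` cdom c)) (cmap c)"
    and o: "openin X (cdom c)"
    using M by (auto simp: smooth_manifold_def)
  have "openin (top_of_set (cmap c ` cdom c)) (cmap c ` cdom c \<inter> W)"
    using W by (rule openin_open_Int)
  from openin_continuous_map_preimage[OF homeomorphic_imp_continuous_map[OF h] this]
  have "openin (subtopology X (cdom c)) {p \<in> topspace (subtopology X (cdom c)). cmap c p \<in> cmap c ` cdom c \<inter> W}" .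
  moreover have "{p \<in> topspace (subtopology X (cdom c)). cmap c p \<in> cmap c ` cdom c \<inter> W}
      = {p \<in> cdom c. cmap c p \<in> W}"
    using openin_subset[OF o] by auto
  ultimately show ?thesis
    using o openin_trans_full by metis
qed

lemma transition_cmap:
  assumes "smooth_manifold X A" "d \<in> A" "p \<in> cdom d"
  shows "transition d c (cmap d p) = cmap c p"
  using smooth_manifold_inj_on[OF assms(1,2)] assms(3) by (simp add: transition_def)

text \<open>The map \<open>L\<close> is the derivative of the transition map. It is injective because a tangent vector determines
its components in each chart.\<close>

lemma local_rep_transition:
  assumes M: "smooth_manifold X A" "c \<in> A" "d \<in> A" and p: "p \<in> cdom c" "p \<in> cdom d"
  obtains L where "linear L" "inj L"
    "\<And>f y. local_rep A d f (cmap d p, y) = local_rep A c f (cmap c p, L y)"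
proof -
  let ?L = "frechet_derivative (transition d c) (at (cmap d p))"
  have x: "cmap d p \<in> cmap d ` (cdom d \<inter> cdom c)" using p by auto
  have tv: "tangent_vec A c (cmap c p) (?L y) = tangent_vec A d (cmap d p) y" for y
    using tangent_vec_transition[OF M(1,3,2) x, of y] transition_cmap[OF M(1,3) p(2), of c] by simp
  show ?thesis
  proof
    show "linear ?L"
      by (rule linear_frechet_derivative[OF transition_differentiable[OF M(1,3,2) x]])
    show "inj ?L"
    proof (rule injI)
      fix y z assume "?L y = ?L z"
      then have "tangent_vec A d (cmap d p) y = tangent_vec A d (cmap d p) z"
        using tv by metis
      then show "y = z"
        using snd_tangent_vec_self[OF M(1,3)] p(2) by (metis imageI)
    qed
    show "local_rep A d f (cmap d p, y) = local_rep A c f (cmap c p, ?L y)" for f y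
      by (simp add: local_rep_def tv)
  qed
qed

lemma finsler_on_subset:
  assumes "finsler_on A U F" "V \<subseteq> U"
  shows "finsler_on A V F"
proof -
  have base: "cmap c ` (cdom c \<inter> V) \<subseteq> cmap c ` (cdom c \<inter> U)" for c :: "('a, 'b) chart"
    using assms(2) by blast
  then have "slit_coords c V \<subseteq> slit_coords c U" for c :: "('a, 'b) chart"
    unfolding slit_coords_def by (intro Sigma_mono) auto
  then show ?thesis
    using assms(1) base smooth_on_subset unfolding finsler_on_def by (meson subsetD)
qed

lemma parallel_chartI:
  assumes M: "smooth_manifold X A" "c \<in> A" and F: "finsler_on A (topspace X) F"
    and \<beta>: "parallel_form X A F \<beta>" and U: "openin X U"
  shows "parallel_chart (cmap c ` (cdom c \<inter> U)) (local_rep A c F) (form_coeff A c \<beta>) (local_rep A c \<beta>)"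
proof -
  have sub: "U \<subseteq> topspace X" using U by (rule openin_subset)
  have FU: "finsler_on A U F" by (rule finsler_on_subset[OF F sub])
  have one: "one_form A \<beta>"
    and par: "\<And>x y i j. (x, y) \<in> slit_coords c (topspace X) \<Longrightarrow>
        frechet_derivative (form_coeff A c \<beta> i) (at x) (axis j 1)
        = (\<Sum>h\<in>UNIV. berwald_conn (local_rep A c F) h i j (x, y) * form_coeff A c \<beta> h x)"
    using \<beta> M(2) unfolding parallel_form_def by fastforce+
  show ?thesis
  proof
    show "open (cmap c ` (cdom c \<inter> U))" by (rule smooth_manifold_open_overlap[OF M U])
    show "smooth_on (cmap c ` (cdom c \<inter> U)) (form_coeff A c \<beta> i)" for i
      using one M(2) unfolding one_form_def by (blast intro: smooth_on_subset)
    show "local_rep A c \<beta> (x, y) = (\<Sum>i\<in>UNIV. form_coeff A c \<beta> i x * y $ i)"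
      if "x \<in> cmap c ` (cdom c \<inter> U)" for x y
      using one M(2) that unfolding one_form_def by blast
    show "frechet_derivative (form_coeff A c \<beta> i) (at x) (axis j 1)
        = (\<Sum>h\<in>UNIV. berwald_conn (local_rep A c F) h i j (x, y) * form_coeff A c \<beta> h x)"
      if "x \<in> cmap c ` (cdom c \<inter> U)" "y \<noteq> 0" for x y i j
      using that sub by (intro par) (auto simp: slit_coords_def)
  qed (use FU M(2) in \<open>auto simp: finsler_on_def slit_coords_def\<close>)
qed

text \<open>Vanishing at a point does not depend on the chart, so it defines a subset of the manifold. This is open
by uniqueness for the parallelism equation and closed by continuity, hence a union of components.\<close>

lemma parallel_form_nowhere_zero:
  assumes M: "smooth_manifold X A" and F: "finsler_on A (topspace X) F"
    and \<beta>: "parallel_form X A F \<beta>" "nonzero_form X A \<beta>" and c: "c \<in> A" "p \<in> cdom c"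
  obtains y where "local_rep A c \<beta> (cmap c p, y) \<noteq> 0"
proof -
  define zero where "zero p c \<longleftrightarrow> (\<forall>y. local_rep A c \<beta> (cmap c p, y) = 0)" for p c
  have change: "zero p d" if "zero p c" "c \<in> A" "d \<in> A" "p \<in> cdom c" "p \<in> cdom d" for p c d
    using local_rep_transition[OF M that(2-5)] that(1) unfolding zero_def by metis
  define Z where "Z = {p \<in> topspace X. \<forall>c\<in>A. p \<in> cdom c \<longrightarrow> zero p c}"
  have cover: "\<exists>c\<in>A. p \<in> cdom c" if "p \<in> topspace X" for p
    using M that unfolding smooth_manifold_def by blast
  have chart_sub: "cdom c \<subseteq> topspace X" if "c \<in> A" for c
    using M that openin_subset unfolding smooth_manifold_def by blast
  have Zc: "p \<in> Z \<longleftrightarrow> zero p c" if "c \<in> A" "p \<in> cdom c" for p c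
    using that change chart_sub unfolding Z_def by blast
  have chart: "parallel_chart (cmap c ` cdom c) (local_rep A c F) (form_coeff A c \<beta>) (local_rep A c \<beta>)"
    if "c \<in> A" for c
    using parallel_chartI[OF M that F \<beta>(1) openin_topspace] chart_sub[OF that] by (simp add: Int_absorb2)
  have openZ: "openin X Z"
  proof (subst openin_subopen, intro ballI)
    fix p assume p: "p \<in> Z"
    then obtain c where c: "c \<in> A" "p \<in> cdom c" using cover Z_def by blast
    interpret parallel_chart "cmap c ` cdom c" "local_rep A c F" "form_coeff A c \<beta>" "local_rep A c \<beta>"
      by (rule chart[OF c(1)])
    have "zero q c \<longleftrightarrow> form_vec (cmap c q) = 0" if "q \<in> cdom c" for q
      using that by (auto simp: zero_def form_inner)
    then have zf: "q \<in> Z \<longleftrightarrow> form_vec (cmap c q) = 0" if "q \<in> cdom c" for q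
      using Zc[OF c(1) that] that by blast
    have "cmap c p \<in> cmap c ` cdom c" "form_vec (cmap c p) = 0"
      using c(2) zf[OF c(2)] p by auto
    then obtain r where r: "r > 0" "\<And>x. x \<in> ball (cmap c p) r \<Longrightarrow> form_vec x = 0"
      by (rule form_vanishes_near_zero) (rule that)
    show "\<exists>T. openin X T \<and> p \<in> T \<and> T \<subseteq> Z"
    proof (intro exI conjI)
      show "openin X {q \<in> cdom c. cmap c q \<in> ball (cmap c p) r}"
        by (rule openin_chart_preimage[OF M c(1) open_ball])
    qed (use r c zf in auto)
  qed
  have "openin X (topspace X - Z)"
  proof (subst openin_subopen, intro ballI)
    fix p assume p: "p \<in> topspace X - Z"
    then obtain c where c: "c \<in> A" "p \<in> cdom c" using cover by blast
    interpret parallel_chart "cmap c ` cdom c" "local_rep A c F" "form_coeff A c \<beta>" "local_rep A c \<beta>"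
      by (rule chart[OF c(1)])
    obtain y where y: "local_rep A c \<beta> (cmap c p, y) \<noteq> 0"
      using p Zc[OF c] by (auto simp: zero_def)
    define W where "W = cmap c ` cdom c \<inter> (\<lambda>x. \<Sum>i\<in>UNIV. form_coeff A c \<beta> i x * y $ i) -` (- {0})"
    have "open W"
      unfolding W_def
      by (intro continuous_open_preimage open_D continuous_intros smooth_on_continuous[OF smooth_b]
          open_Compl closed_singleton)
    then have "openin X {q \<in> cdom c. cmap c q \<in> W}"
      by (rule openin_chart_preimage[OF M c(1)])
    moreover have "p \<in> {q \<in> cdom c. cmap c q \<in> W}"
      using c(2) y by (simp add: W_def form)
    moreover have "q \<in> topspace X - Z" if "q \<in> {q \<in> cdom c. cmap c q \<in> W}" for q
    proof -
      have "local_rep A c \<beta> (cmap c q, y) \<noteq> 0" using that by (simp add: W_def form)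
      then show ?thesis using that Zc[OF c(1)] chart_sub[OF c(1)] by (auto simp: zero_def)
    qed
    ultimately show "\<exists>T. openin X T \<and> p \<in> T \<and> T \<subseteq> topspace X - Z" by blast
  qed
  then have closedZ: "closedin X Z"
    by (auto simp: closedin_def Z_def)
  have "p \<notin> Z"
  proof
    assume p: "p \<in> Z"
    define K where "K = connected_component_of_set X p"
    have pX: "p \<in> topspace X" using p Z_def by blast
    then have K: "K \<in> connected_components_of X" "p \<in> K"
      by (auto simp: K_def connected_components_of_def connected_component_of_refl)
    have "connectedin X K" unfolding K_def by (rule connectedin_connected_component_of)
    then have "K \<subseteq> Z"
      using connectedin_clopen_cases[OF _ closedZ openZ] K(2) p by (auto simp: disjnt_iff)
    moreover obtain q d y where "q \<in> K" "d \<in> A" "q \<in> cdom d" "local_rep A d \<beta> (cmap d q, y) \<noteq> 0"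
      using \<beta>(2) K(1) unfolding nonzero_form_def by blast
    ultimately show False using Zc unfolding zero_def by blast
  qed
  then show ?thesis using Zc[OF c] that by (auto simp: zero_def)
qed

lemma local_rep_deform: "local_rep A c (deform \<epsilon> F \<beta>) = deform \<epsilon> (local_rep A c F) (local_rep A c \<beta>)"
  by (simp add: fun_eq_iff local_rep_def deform_def)

theorem theorem3p6:
  fixes X :: "'m topology"
    and A :: "('m, 'n::finite) chart set"
    and F \<beta> :: "('m, 'n) tangent \<Rightarrow> real"
  assumes "CARD('n) \<ge> 2"
    and "smooth_manifold X A"
    and "landsberg_space X A F"
    and "parallel_form X A F \<beta>"
    and "nonzero_form X A \<beta>"
  shows "metrizability_freedom_ge_2 X A (geodesic_spray A F)"
  unfolding metrizability_freedom_ge_2_def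
proof
  note M = assms(2)
  have F: "finsler_on A (topspace X) F" using assms(3) by (simp add: landsberg_space_def)
  fix p assume p: "p \<in> topspace X"
  then obtain c where c: "c \<in> A" "p \<in> cdom c"
    using M unfolding smooth_manifold_def by blast
  have sub: "cdom d \<inter> topspace X = cdom d" if "d \<in> A" for d
    using M that openin_subset unfolding smooth_manifold_def by blast
  have chart: "parallel_chart (cmap d ` cdom d) (local_rep A d F) (form_coeff A d \<beta>) (local_rep A d \<beta>)"
    if "d \<in> A" for d
    using parallel_chartI[OF M that F assms(4) openin_topspace] sub[OF that] by simp
  interpret C: parallel_chart "cmap c ` cdom c" "local_rep A c F" "form_coeff A c \<beta>" "local_rep A c \<beta>"
    by (rule chart[OF c(1)])
  \<comment> \<open>The parameter is chosen in one chart, over a compact ball; the neighbourhood is the open ball.\<close>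
  obtain r where r: "r > 0" "cball (cmap c p) r \<subseteq> cmap c ` cdom c"
    using C.open_D c(2) open_contains_cball by (metis imageI)
  obtain \<epsilon> where \<epsilon>: "\<epsilon> > 0"
    "\<And>x y. x \<in> cball (cmap c p) r \<Longrightarrow> y \<noteq> 0 \<Longrightarrow> 1 + \<epsilon> * C.form_norm2 (x, y) > 0"
    using C.exists_deformation_parameter[OF compact_cball r(2)] by blast
  define U where "U = {q \<in> cdom c. cmap c q \<in> ball (cmap c p) r}"
  have openU: "openin X U"
    unfolding U_def by (rule openin_chart_preimage[OF M c(1) open_ball])
  then have U: "openin X U" "p \<in> U" "U \<subseteq> topspace X"
    using openin_subset[OF openU] c(2) r(1) by (auto simp: U_def)
  have chartU: "parallel_chart (cmap d ` (cdom d \<inter> U)) (local_rep A d F) (form_coeff A d \<beta>) (local_rep A d \<beta>)"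
    if "d \<in> A" for d
    by (rule parallel_chartI[OF M that F assms(4) U(1)])
  let ?F = "deform \<epsilon> F \<beta>"
  have rank: "rank (metric_tensor (local_rep A d ?F) (x, y)) = CARD('n)"
    if d: "d \<in> A" and x: "x \<in> cmap d ` (cdom d \<inter> U)" and y: "y \<noteq> 0" for d x y
  proof -
    obtain q where q: "x = cmap d q" "q \<in> cdom d" "q \<in> U" using x by blast
    have qc: "q \<in> cdom c" "cmap c q \<in> cball (cmap c p) r" using q(3) by (auto simp: U_def)
    interpret D: parallel_chart "cmap d ` cdom d" "local_rep A d F" "form_coeff A d \<beta>" "local_rep A d \<beta>"
      by (rule chart[OF d])
    obtain L where L: "linear L" "inj L"
      "\<And>f y. local_rep A d f (cmap d q, y) = local_rep A c f (cmap c q, L y)"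
      using local_rep_transition[OF M c(1) d qc(1) q(2)] by metis
    have Ly: "L y \<noteq> 0" using L(1,2) y linear_injective_0 by blast
    show ?thesis
      unfolding q(1)
    proof (rule rank_metric_tensor_linear_change[OF D.open_slit _ _ C.open_slit _ _ L(1,2) y])
      show "smooth_on (cmap d ` cdom d \<times> - {0}) (local_rep A d ?F)"
        "smooth_on (cmap c ` cdom c \<times> - {0}) (local_rep A c ?F)"
        using D.smooth_deform C.smooth_deform \<epsilon>(1) by (simp_all add: local_rep_deform)
      show "rank (metric_tensor (local_rep A c ?F) (cmap c q, L y)) = CARD('n)"
        unfolding local_rep_deform
        by (rule C.rank_deform) (use \<epsilon> qc Ly in auto)
    qed (use q qc L(3) in auto)
  qed
  have finsler: "finsler_on A U ?F"
    unfolding finsler_on_def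
  proof (intro ballI conjI allI impI)
    fix d assume d: "d \<in> A"
    interpret D: parallel_chart "cmap d ` (cdom d \<inter> U)" "local_rep A d F" "form_coeff A d \<beta>" "local_rep A d \<beta>"
      by (rule chartU[OF d])
    show "smooth_on (slit_coords d U) (local_rep A d ?F)"
      using D.smooth_deform \<epsilon>(1) by (simp add: local_rep_deform slit_coords_def)
    show "local_rep A d ?F v > 0" if "v \<in> slit_coords d U" for v
      using D.deform_pos \<epsilon>(1) that by (simp add: local_rep_deform slit_coords_def)
    show "local_rep A d ?F (x, t *\<^sub>R y) = t * local_rep A d ?F (x, y)"
      if "x \<in> cmap d ` (cdom d \<inter> U)" "t > 0" for x y t
      using D.deform_homogeneous[OF that] by (simp add: local_rep_deform)
    show "rank (metric_tensor (local_rep A d ?F) v) = CARD('n)" if "v \<in> slit_coords d U" for v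
      using rank[OF d] that by (auto simp: slit_coords_def)
  qed
  have spray: "geodesic_spray A ?F d v = geodesic_spray A F d v"
    if d: "d \<in> A" and v: "v \<in> slit_coords d U" for d v
  proof -
    interpret D: parallel_chart "cmap d ` (cdom d \<inter> U)" "local_rep A d F" "form_coeff A d \<beta>" "local_rep A d \<beta>"
      by (rule chartU[OF d])
    obtain x y where xy: "v = (x, y)" "x \<in> cmap d ` (cdom d \<inter> U)" "y \<noteq> 0"
      using v by (auto simp: slit_coords_def)
    have "spray_coeff (local_rep A d ?F) i v = spray_coeff (local_rep A d F) i v" for i
      using D.spray_deform[OF _ xy(2,3)] rank[OF d xy(2,3)] \<epsilon>(1) by (simp add: local_rep_deform xy(1))
    then show ?thesis by (simp add: geodesic_spray_def)
  qed
  have independent: "functionally_independent_on A U F ?F"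
    unfolding functionally_independent_on_def
  proof
    fix d assume d: "d \<in> A"
    interpret D: parallel_chart "cmap d ` (cdom d \<inter> U)" "local_rep A d F" "form_coeff A d \<beta>" "local_rep A d \<beta>"
      by (rule chartU[OF d])
    have "D.form_vec x \<noteq> 0" if x: "x \<in> cmap d ` (cdom d \<inter> U)" for x
    proof -
      obtain q where q: "x = cmap d q" "q \<in> cdom d" using x by blast
      obtain y where "local_rep A d \<beta> (x, y) \<noteq> 0"
        using parallel_form_nowhere_zero[OF M F assms(4,5) d q(2)] q(1) by blast
      then show ?thesis using D.form_inner[OF x] by auto
    qed
    from D.functionally_independent_deform[OF assms(1) \<epsilon>(1) this]
    show "slit_coords d U \<subseteq> closure {v \<in> slit_coords d U.
        \<exists>a b. wedge_diff (local_rep A d F) (local_rep A d ?F) v a b \<noteq> 0}"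
      by (simp add: local_rep_deform slit_coords_def)
  qed
  show "\<exists>U F1 F2. openin X U \<and> p \<in> U \<and> finsler_on A U F1 \<and> finsler_on A U F2 \<and>
      (\<forall>c\<in>A. \<forall>v\<in>slit_coords c U. geodesic_spray A F1 c v = geodesic_spray A F c v \<and>
        geodesic_spray A F2 c v = geodesic_spray A F c v) \<and>
      functionally_independent_on A U F1 F2"
    using U finsler_on_subset[OF F U(3)] finsler spray independent by blast
qed

end
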